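(* Let $X$ be a compact median algebra of finite rank $n$. Then for every continuous median-preserving action of a topological group $G$ on $X$ the dynamical system $(G,X)$ is Rosenthal representable (in particular, dynamically tame). Thus, there exist a Rosenthal Banach space $V$, a continuous homomorphism $h:G\to\operatorname{Iso}(V)$ and a weak-star $G$-embedding $\alpha:X\to V^*$.
   Context: A median algebra is a set $X$ with a ternary operation $m:X^3\to X$ such that $m$ is invariant under permutations of its arguments, $m(a,b,b)=b$, and $m(m(a,x,b),x,c)=m(a,x,m(b,x,c))$ for all $a,b,c,x\in X$. A compact median algebra is a compact Hausdorff space with a continuous median operation. The rank of $X$ is the supremum of the $n\in\mathbb N$ such that $\{0,1\}^n$ (with coordinatewise median) embeds in $X$ as a median subalgebra. An action of $G$ on $X$ is continuous if the map $G\times X\to X$ is (jointly) continuous, and median-preserving if $g\,m(x,y,z)=m(gx,gy,gz)$ for all $g\in G$ and $x,y,z\in X$. A Banach space $V$ is Rosenthal if it contains no isomorphic copy of $\ell_1$. $\operatorname{Iso}(V)$ is the topological group of all linear onto isometries $V\to V$ with the strong operator topology. A continuous homomorphism $h:G\to\operatorname{Iso}(V)$ induces the dual action of $G$ on $V^*$, $(g\varphi)(v)=\varphi(h(g)^{-1}v)$, which is continuous on the weak-star compact unit ball $B_{V^*}$. A $G$-space $X$ is Rosenthal representable if there are a Rosenthal Banach space $V$, a continuous homomorphism $h:G\to\operatorname{Iso}(V)$ and a $G$-equivariant topological embedding of $X$ into $B_{V^*}$ with the weak-star topology. A weak-star $G$-embedding $\alpha:X\to V^*$ is a $G$-equivariant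 map that is a topological embedding for the weak-star topology. A sequence $(f_n)_{n\in\mathbb N}$ of bounded real functions on $X$ is independent if there are reals $a<b$ such that $\bigcap_{i\in P}f_i^{-1}(-\infty,a]\cap\bigcap_{j\in M}f_j^{-1}[b,\infty)\ne\varnothing$ for all finite disjoint $P,M\subset\mathbb N$. A compact $G$-system $X$ is (dynamically) tame if for every continuous $f:X\to\mathbb R$ the orbit $fG=\{x\mapsto f(gx): g\in G\}$ contains no infinite independent sequence. *)

theory Defs
  imports "HOL-Analysis.Analysis" "HOL-Library.Extended_Nat"
begin

section \<open>Median algebras\<close>

text \<open>The first two assumptions generate the invariance under all permutations of the arguments.\<close>

locale median_algebra =
  fixes m :: "'x \<Rightarrow> 'x \<Rightarrow> 'x \<Rightarrow> 'x"
  assumes swap12: "m a b c = m b a c"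
    and swap23: "m a b c = m a c b"
    and majority: "m a b b = b"
    and assoc: "m (m a x b) x c = m a x (m b x c)"

locale compact_median_algebra = median_algebra m
  for m :: "'x::t2_space \<Rightarrow> 'x \<Rightarrow> 'x \<Rightarrow> 'x" +
  assumes compact: "compact (UNIV :: 'x set)"
    and continuous: "continuous_on UNIV (\<lambda>(a, b, c). m a b c)"

text \<open>The cube \<open>{0,1}\<close> to the power \<open>n\<close>, as extensional functions on \<open>{..<n}\<close>.\<close>

definition cube :: "nat \<Rightarrow> (nat \<Rightarrow> bool) set" where
  "cube n = {..<n} \<rightarrow>\<^sub>E UNIV"

definition cube_median ::
    "nat \<Rightarrow> (nat \<Rightarrow> bool) \<Rightarrow> (nat \<Rightarrow> bool) \<Rightarrow> (nat \<Rightarrow> bool) \<Rightarrow> nat \<Rightarrow> bool" where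
  "cube_median n u v w = (\<lambda>i\<in>{..<n}. (u i \<and> v i) \<or> (v i \<and> w i) \<or> (u i \<and> w i))"

definition cube_embeds :: "nat \<Rightarrow> ('x \<Rightarrow> 'x \<Rightarrow> 'x \<Rightarrow> 'x) \<Rightarrow> bool" where
  "cube_embeds n m \<longleftrightarrow> (\<exists>f. inj_on f (cube n) \<and>
     (\<forall>u\<in>cube n. \<forall>v\<in>cube n. \<forall>w\<in>cube n. f (cube_median n u v w) = m (f u) (f v) (f w)))"

definition median_rank :: "('x \<Rightarrow> 'x \<Rightarrow> 'x \<Rightarrow> 'x) \<Rightarrow> enat" where
  "median_rank m = (SUP n \<in> {n. cube_embeds n m}. enat n)"


section \<open>Group actions\<close>

text \<open>
  Topological groups are given by the class \<^class>\<open>topological_group_add\<close>. It does not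
  assume commutativity: the group is arbitrary and is merely written additively.
\<close>

definition continuous_action ::
    "('g::topological_group_add \<Rightarrow> 'x::topological_space \<Rightarrow> 'x) \<Rightarrow> bool" where
  "continuous_action act \<longleftrightarrow>
     (\<forall>x. act 0 x = x) \<and>
     (\<forall>g h x. act (g + h) x = act g (act h x)) \<and>
     continuous_on UNIV (\<lambda>(g, x). act g x)"

definition median_preserving ::
    "('x \<Rightarrow> 'x \<Rightarrow> 'x \<Rightarrow> 'x) \<Rightarrow> ('g \<Rightarrow> 'x \<Rightarrow> 'x) \<Rightarrow> bool" where
  "median_preserving m act \<longleftrightarrow>
     (\<forall>g x y z. act g (m x y z) = m (act g x) (act g y) (act g z))"


section \<open>Tameness\<close>

definition independent_seq :: "(nat \<Rightarrow> 'x \<Rightarrow> real) \<Rightarrow> bool" where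
  "independent_seq F \<longleftrightarrow> (\<exists>a b. a < b \<and>
     (\<forall>P M. finite P \<and> finite M \<and> P \<inter> M = {} \<longrightarrow>
        (\<Inter>i\<in>P. F i -` {..a}) \<inter> (\<Inter>j\<in>M. F j -` {b..}) \<noteq> {}))"

text \<open>
  The members of an independent sequence are automatically pairwise distinct, and on a
  compact space the members of the orbit of a continuous function are automatically bounded.
\<close>

definition tame_system :: "('g \<Rightarrow> 'x::topological_space \<Rightarrow> 'x) \<Rightarrow> bool" where
  "tame_system act \<longleftrightarrow> (\<forall>f :: 'x \<Rightarrow> real. continuous_on UNIV f \<longrightarrow>
     \<not> (\<exists>F. range F \<subseteq> range (\<lambda>g x. f (act g x)) \<and> independent_seq F))"


section \<open>Banach spaces with a carrier\<close>

text \<open>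
  HOL cannot quantify existentially over types, so a Banach space is given by a linear subspace
  \<open>V\<close> of some ambient real vector space together with a norm \<open>N\<close>, of which only the values on
  \<open>V\<close> matter. No topology or norm of the ambient space is used.
\<close>

definition linear_map_on :: "'v::real_vector set \<Rightarrow> ('v \<Rightarrow> 'w::real_vector) \<Rightarrow> bool" where
  "linear_map_on V T \<longleftrightarrow>
     (\<forall>u\<in>V. \<forall>v\<in>V. T (u + v) = T u + T v) \<and> (\<forall>c. \<forall>v\<in>V. T (c *\<^sub>R v) = c *\<^sub>R T v)"

definition norm_on :: "'v::real_vector set \<Rightarrow> ('v \<Rightarrow> real) \<Rightarrow> bool" where
  "norm_on V N \<longleftrightarrow>
     (\<forall>v\<in>V. 0 \<le> N v \<and> (N v = 0 \<longleftrightarrow> v = 0)) \<and>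
     (\<forall>c. \<forall>v\<in>V. N (c *\<^sub>R v) = \<bar>c\<bar> * N v) \<and>
     (\<forall>u\<in>V. \<forall>v\<in>V. N (u + v) \<le> N u + N v)"

text \<open>
  \<^locale>\<open>Metric_space\<close> requires nonnegativity and symmetry of the distance outside the carrier
  as well, whence the case distinction.
\<close>

definition norm_dist :: "'v::real_vector set \<Rightarrow> ('v \<Rightarrow> real) \<Rightarrow> 'v \<Rightarrow> 'v \<Rightarrow> real" where
  "norm_dist V N u v = (if u \<in> V \<and> v \<in> V then N (u - v) else 0)"

lemma Metric_space_norm_dist:
  assumes "subspace V" "norm_on V N"
  shows "Metric_space V (norm_dist V N)"
proof
  have diff: "u - v \<in> V" if "u \<in> V" "v \<in> V" for u v
    using assms(1) that by (rule subspace_diff)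
  show "0 \<le> norm_dist V N u v" for u v
    using assms(2) diff by (auto simp: norm_dist_def norm_on_def)
  have minus: "N (v - u) = N (u - v)" if "u \<in> V" "v \<in> V" for u v
  proof -
    have "N ((-1) *\<^sub>R (u - v)) = \<bar>-1\<bar> * N (u - v)"
      using assms(2) diff[OF that] unfolding norm_on_def by blast
    moreover have "(-1) *\<^sub>R (u - v) = v - u"
      by (simp only: scaleR_minus_left scaleR_one minus_diff_eq)
    ultimately show ?thesis
      by (simp only: abs_minus_cancel abs_one mult_1)
  qed
  show "norm_dist V N u v = norm_dist V N v u" for u v
  proof (cases "u \<in> V \<and> v \<in> V")
    case True
    then show ?thesis unfolding norm_dist_def using minus[of v u] by presburger
  next
    case False
    then show ?thesis unfolding norm_dist_def by presburger
  qed
  show "norm_dist V N u v = 0 \<longleftrightarrow> u = v" if "u \<in> V" "v \<in> V" for u v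
  proof -
    have "N (u - v) = 0 \<longleftrightarrow> u - v = 0"
      using assms(2) diff[OF that] unfolding norm_on_def by blast
    then show ?thesis using that by (simp add: norm_dist_def)
  qed
  show "norm_dist V N u w \<le> norm_dist V N u v + norm_dist V N v w"
    if "u \<in> V" "v \<in> V" "w \<in> V" for u v w
  proof -
    have "N ((u - v) + (v - w)) \<le> N (u - v) + N (v - w)"
      using assms(2) diff[OF that(1,2)] diff[OF that(2,3)] unfolding norm_on_def by blast
    then show ?thesis using that by (simp add: norm_dist_def)
  qed
qed

definition norm_topology :: "'v::real_vector set \<Rightarrow> ('v \<Rightarrow> real) \<Rightarrow> 'v topology" where
  "norm_topology V N = Metric_space.mtopology V (norm_dist V N)"

definition banach_space_on :: "'v::real_vector set \<Rightarrow> ('v \<Rightarrow> real) \<Rightarrow> bool" where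
  "banach_space_on V N \<longleftrightarrow>
     subspace V \<and> norm_on V N \<and> Metric_space.mcomplete V (norm_dist V N)"

definition ell1 :: "(nat \<Rightarrow> real) set" where
  "ell1 = {x. summable (\<lambda>n. \<bar>x n\<bar>)}"

definition ell1_norm :: "(nat \<Rightarrow> real) \<Rightarrow> real" where
  "ell1_norm x = (\<Sum>n. \<bar>x n\<bar>)"

definition contains_ell1 :: "'v::real_vector set \<Rightarrow> ('v \<Rightarrow> real) \<Rightarrow> bool" where
  "contains_ell1 V N \<longleftrightarrow> (\<exists>T :: (nat \<Rightarrow> real) \<Rightarrow> 'v.
     T ` ell1 \<subseteq> V \<and>
     (\<forall>x\<in>ell1. \<forall>y\<in>ell1. T (\<lambda>n. x n + y n) = T x + T y) \<and>
     (\<forall>c. \<forall>x\<in>ell1. T (\<lambda>n. c * x n) = c *\<^sub>R T x) \<and>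
     (\<exists>c C. 0 < c \<and> (\<forall>x\<in>ell1. c * ell1_norm x \<le> N (T x) \<and> N (T x) \<le> C * ell1_norm x)))"

definition rosenthal_space_on :: "'v::real_vector set \<Rightarrow> ('v \<Rightarrow> real) \<Rightarrow> bool" where
  "rosenthal_space_on V N \<longleftrightarrow> banach_space_on V N \<and> \<not> contains_ell1 V N"

text \<open>
  Operators and functionals on \<open>V\<close> are extensional functions, so that equality of functions is
  equality on \<open>V\<close>; the topologies of pointwise convergence are then subspaces of products.
\<close>

definition Iso :: "'v::real_vector set \<Rightarrow> ('v \<Rightarrow> real) \<Rightarrow> ('v \<Rightarrow> 'v) set" where
  "Iso V N = {T \<in> V \<rightarrow>\<^sub>E V. linear_map_on V T \<and> T ` V = V \<and> (\<forall>v\<in>V. N (T v) = N v)}"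

definition strong_operator_topology ::
    "'v::real_vector set \<Rightarrow> ('v \<Rightarrow> real) \<Rightarrow> ('v \<Rightarrow> 'v) topology" where
  "strong_operator_topology V N =
     subtopology (product_topology (\<lambda>_. norm_topology V N) V) (Iso V N)"

definition continuous_hom_Iso ::
    "'v::real_vector set \<Rightarrow> ('v \<Rightarrow> real) \<Rightarrow> ('g::topological_group_add \<Rightarrow> 'v \<Rightarrow> 'v) \<Rightarrow> bool" where
  "continuous_hom_Iso V N h \<longleftrightarrow>
     (\<forall>g. h g \<in> Iso V N) \<and>
     (\<forall>g k. h (g + k) = compose V (h g) (h k)) \<and>
     continuous_map euclidean (strong_operator_topology V N) h"

definition dual :: "'v::real_vector set \<Rightarrow> ('v \<Rightarrow> real) \<Rightarrow> ('v \<Rightarrow> real) set" where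
  "dual V N =
     {\<phi> \<in> extensional V. linear_map_on V \<phi> \<and> (\<exists>C. \<forall>v\<in>V. \<bar>\<phi> v\<bar> \<le> C * N v)}"

definition dual_ball :: "'v::real_vector set \<Rightarrow> ('v \<Rightarrow> real) \<Rightarrow> ('v \<Rightarrow> real) set" where
  "dual_ball V N = {\<phi> \<in> dual V N. \<forall>v\<in>V. \<bar>\<phi> v\<bar> \<le> N v}"

definition weak_star_topology ::
    "'v::real_vector set \<Rightarrow> ('v \<Rightarrow> real) \<Rightarrow> ('v \<Rightarrow> real) topology" where
  "weak_star_topology V N = subtopology (product_topology (\<lambda>_. euclideanreal) V) (dual V N)"

definition dual_action ::
    "'v set \<Rightarrow> ('g \<Rightarrow> 'v \<Rightarrow> 'v) \<Rightarrow> 'g \<Rightarrow> ('v \<Rightarrow> real) \<Rightarrow> 'v \<Rightarrow> real" where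
  "dual_action V h g \<phi> = (\<lambda>v\<in>V. \<phi> (inv_into V (h g) v))"


section \<open>Rosenthal representability\<close>

definition equivariant ::
    "('g \<Rightarrow> 'x \<Rightarrow> 'x) \<Rightarrow> ('g \<Rightarrow> 'y \<Rightarrow> 'y) \<Rightarrow> ('x \<Rightarrow> 'y) \<Rightarrow> bool" where
  "equivariant act act' \<alpha> \<longleftrightarrow> (\<forall>g x. \<alpha> (act g x) = act' g (\<alpha> x))"

definition weak_star_G_embedding ::
    "'v::real_vector set \<Rightarrow> ('v \<Rightarrow> real) \<Rightarrow> ('g \<Rightarrow> 'v \<Rightarrow> 'v) \<Rightarrow>
     ('g \<Rightarrow> 'x::topological_space \<Rightarrow> 'x) \<Rightarrow> ('x \<Rightarrow> 'v \<Rightarrow> real) \<Rightarrow> bool" where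
  "weak_star_G_embedding V N h act \<alpha> \<longleftrightarrow>
     equivariant act (dual_action V h) \<alpha> \<and>
     embedding_map euclidean (weak_star_topology V N) \<alpha>"

text \<open>
  The type argument is the ambient vector space in which the carrier of \<open>V\<close> is to be found.
  For \<open>'v = 'x \<Rightarrow>\<^sub>C real\<close> (and \<open>X\<close> compact) it is no restriction: given any Rosenthal
  representation \<open>\<alpha>\<close> on \<open>V\<close>, the map \<open>r\<close> sending \<open>v\<close> to the continuous function
  \<open>x \<mapsto> \<alpha> x v\<close> is linear and its kernel is closed and \<open>G\<close>-invariant. The quotient of \<open>V\<close>
  by the kernel is again a Rosenthal space (copies of \<open>\<ell>\<^sub>1\<close> lift through quotient maps) on
  which \<open>G\<close> acts strongly continuously by isometries, \<open>\<alpha>\<close> takes its values in the dual of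
  the quotient, and the quotient is linearly isomorphic to the range of \<open>r\<close>, with the
  transported norm.
\<close>

definition rosenthal_representable_in ::
    "'v::real_vector itself \<Rightarrow> ('g::topological_group_add \<Rightarrow> 'x::topological_space \<Rightarrow> 'x) \<Rightarrow> bool"
  where
  "rosenthal_representable_in _ act \<longleftrightarrow>
     (\<exists>(V :: 'v set) N h \<alpha>.
        rosenthal_space_on V N \<and>
        continuous_hom_Iso V N h \<and>
        equivariant act (dual_action V h) \<alpha> \<and>
        embedding_map euclidean (subtopology (weak_star_topology V N) (dual_ball V N)) \<alpha>)"

end

theory Submission
  imports Defs "HOL-Real_Asymp.Real_Asymp"
begin

text \<open>
  In a median algebra of rank \<open>n\<close>, crossing halfspaces generate cubes. This bounds the Caratheodory
  number, so compact median algebras of finite rank are locally convex, and a Urysohn argument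
  through chains of halfspaces yields enough continuous functions whose sublevel sets are all
  halfspaces. By the Sauer--Shelah lemma, \<open>k\<close> such functions have only polynomially many sign
  patterns. This excludes independence outright, which gives tameness, and it makes Rademacher
  averages of such functions sublinear in norm, uniformly. The latter property passes to convex
  hulls by Jensen's inequality, without Rosenthal's theorem on \<open>\<ell>\<^sub>1\<close>. The interpolation of Davis,
  Figiel, Johnson and Pelczynski turns it into an invariant Banach space of continuous functions
  containing no copy of \<open>\<ell>\<^sub>1\<close>; the points of the algebra act on it by evaluation.
\<close>

section \<open>Halfspaces in median algebras\<close>

text \<open>A change of norm cannot be avoided: on an interval the functions in question are the
  monotone ones, their closed span is the space of all continuous functions, and that contains
  \<open>ell1\<close>. Smallness is available only on \<open>atoms\<close> and its convex hull
  \<open>W\<close>, so the new norm has to keep its unit vectors close to multiples of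
  \<open>W\<close>. Signs are averaged for two reasons. On the unit vectors of \<open>ell1\<close>
  every signed sum of \<open>k\<close> terms has norm \<open>k\<close>, so one choice of signs with
  a sum of smaller order already destroys a copy of \<open>ell1\<close>. And the average over all
  signs is a convex function of each vector, so its bounds carry over to \<open>W\<close>. The link
  between rank and counting is that a family of \<open>k\<close> halfspaces realising all patterns
  is exactly a crossing configuration for a \<open>k\<close>-cube: the rank bounds the
  Vapnik-Chervonenkis dimension. The group takes no part in the estimates. It permutes
  \<open>atoms\<close> and preserves the supremum norm, and \<open>K n\<close> is built from these
  two alone, so it acts by isometries; only strong continuity needs an argument.\<close>

context median_algebra
begin

lemma rotate: "m a b c = m b c a"
  using swap12 swap23 by metis

lemma majority' [simp]: "m a b b = b" "m b a b = b" "m b b a = b"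
  using majority swap12 swap23 by metis+

text \<open>
  \<open>below w a b\<close> says that \<open>a\<close> lies in the interval \<open>[w, b]\<close>. For fixed \<open>w\<close> this is the order of the
  meet semilattice \<open>m w\<close> with least element \<open>w\<close>; the whole convexity theory is derived from
  changing the base point \<open>w\<close>.
\<close>

definition below :: "'x \<Rightarrow> 'x \<Rightarrow> 'x \<Rightarrow> bool" where
  "below w a b \<longleftrightarrow> m w a b = a"

lemma below_iff: "below w a b \<longleftrightarrow> m w a b = a" "below w a b \<longleftrightarrow> m w b a = a"
    "below w a b \<longleftrightarrow> m a w b = a" "below w a b \<longleftrightarrow> m a b w = a"
    "below w a b \<longleftrightarrow> m b w a = a" "below w a b \<longleftrightarrow> m b a w = a"
  unfolding below_def using swap12 swap23 by metis+

lemma below_sym: "below w a b \<longleftrightarrow> below b a w"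
  by (metis below_iff)

lemma below_refl [simp]: "below w a a" and below_bot [simp]: "below w w a"
  by (simp_all add: below_def)

lemma meet_assoc: "m w (m w a b) c = m w a (m w b c)"
  by (metis assoc swap12 swap23)

lemma below_meet [simp]: "below w (m w a b) a" "below w (m w a b) b"
  by (metis below_def meet_assoc majority'(1) swap23)+

lemma median_between [simp]:
  "below a (m a b c) b" "below a (m a b c) c" "below b (m a b c) c"
  "below b (m a b c) a" "below c (m a b c) a" "below c (m a b c) b"
  by (metis below_meet swap12 swap23)+

lemma below_trans: "below w a b \<Longrightarrow> below w b c \<Longrightarrow> below w a c"
  by (metis below_def meet_assoc)

lemma below_meetI: "below w a b \<Longrightarrow> below w a c \<Longrightarrow> below w a (m w b c)"
  by (metis below_def meet_assoc)

text \<open>The basic change of base point: a chain read from \<open>w\<close> remains a chain when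
  read from its own second member.\<close>

lemma below_chain: "below w a b \<Longrightarrow> below w b c \<Longrightarrow> below a b c"
  by (metis assoc below_iff majority')

lemma below_bot_unique: "below w a w \<longleftrightarrow> a = w"
  by (auto simp: below_def)

text \<open>A halfspace containing \<open>v\<close> and \<open>p\<close> contains \<open>a\<close>
  or \<open>b\<close>, hence also their median with \<open>v\<close>. Separation by halfspaces rests
  on this lemma, so the proof has to be algebraic: \<open>g'\<close> projects the median
  \<open>g\<close> into the interval from \<open>p\<close> to \<open>v\<close> and turns out to be
  \<open>g\<close>.\<close>

lemma meet_below_between:
  assumes "below a p b"
  shows "below v (m v a b) p"
proof -
  define g where "g = m v a b"
  define s where "s = m p a v"
  define t where "t = m p b v"
  define g' where "g' = m p v g"
  have ag: "m g a b = g" by (metis g_def below_iff median_between)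
  \<comment> \<open>As \<open>p\<close> lies between \<open>a\<close> and \<open>b\<close>,
    exchanging \<open>v\<close> for its projection \<open>g\<close> on their interval does not alter
    \<open>s\<close> and \<open>t\<close>.\<close>
  have project: "m p a (m v a b) = m p a v" if "below a p b" for a b
    using meet_assoc[of a p b v] that rotate swap12 unfolding below_def by metis
  have sg: "s = m p a g"
    unfolding s_def g_def by (rule project[OF assms, symmetric])
  have tg: "t = m p b g"
    unfolding t_def g_def using project[of b a] assms below_sym swap23 by metis
  have sb: "below g s a" "below g s p" "below g t b" "below g t p"
    using median_between sg tg by auto
  \<comment> \<open>Read from \<open>g\<close>, the point \<open>s\<close> is below \<open>a\<close>
    and \<open>t\<close> is below \<open>b\<close>, while \<open>a\<close> and \<open>b\<close> have
    meet \<open>g\<close>.\<close>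
  have "below g (m g s t) (m g a b)"
    by (meson below_meet below_meetI below_trans sb)
  then have st: "m g s t = g" using ag below_bot_unique by auto
  have "below p s g'" "below p t g'" unfolding g'_def
    by (metis below_meetI median_between s_def t_def sg tg)+
  moreover have "below p g' g" by (simp add: g'_def)
  ultimately have "below s g' g" "below t g' g" using below_chain by blast+
  then have "below g g' s" "below g g' t" using below_sym by blast+
  then have "g' = g" using below_meetI st below_bot_unique by metis
  then show ?thesis
    unfolding g_def[symmetric] using g'_def by (metis below_iff)
qed

section \<open>Convex sets, halfspaces and Kakutani separation\<close>

definition cvx :: "'x set \<Rightarrow> bool" where
  "cvx C \<longleftrightarrow> (\<forall>a\<in>C. \<forall>b\<in>C. \<forall>x. m a x b \<in> C)"

lemma cvxI: "(\<And>a b x. a \<in> C \<Longrightarrow> b \<in> C \<Longrightarrow> m a x b \<in> C) \<Longrightarrow> cvx C"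
  by (simp add: cvx_def)

lemma cvxD: "cvx C \<Longrightarrow> a \<in> C \<Longrightarrow> b \<in> C \<Longrightarrow> m a x b \<in> C"
  "cvx C \<Longrightarrow> a \<in> C \<Longrightarrow> b \<in> C \<Longrightarrow> m x a b \<in> C"
  "cvx C \<Longrightarrow> a \<in> C \<Longrightarrow> b \<in> C \<Longrightarrow> m a b x \<in> C"
  unfolding cvx_def using swap12 swap23 by metis+

lemma cvx_below: "cvx C \<Longrightarrow> a \<in> C \<Longrightarrow> b \<in> C \<Longrightarrow> below a x b \<Longrightarrow> x \<in> C"
  unfolding cvx_def below_def by metis

lemma cvx_iff_below: "cvx C \<longleftrightarrow> (\<forall>a\<in>C. \<forall>b\<in>C. \<forall>x. below a x b \<longrightarrow> x \<in> C)"
  unfolding cvx_def by (metis below_def median_between(2) below_iff(5) median_between(6) swap12 swap23)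

text \<open>Joining a point to a convex set needs only one round of intervals. For \<open>w\<close>
  between \<open>u\<close> and \<open>v\<close> the witness is the median of \<open>w\<close> with
  the two given witnesses, which lies in \<open>C\<close> and does not involve
  \<open>a\<close>.\<close>

lemma cvx_join_point:
  assumes "cvx C"
  shows "cvx {x. \<exists>c\<in>C. below a x c}"
  unfolding cvx_iff_below
proof (clarify)
  fix u v w c d assume *: "below u w v" "c \<in> C" "below a u c" "d \<in> C" "below a v d"
  define e where "e = m w c d"
  have "below w (m w a c) u" "below w (m w a d) v"
    using * meet_below_between by blast+
  moreover have "below w (m w a e) (m w a c)" "below w (m w a e) (m w a d)"
    unfolding e_def by (meson below_meet below_meetI below_trans)+
  ultimately have "below w (m w a e) (m w u v)"
    by (meson below_meetI below_trans)
  then have "m w a e = w"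
    using * by (metis below_bot_unique below_iff(3))
  then have "below a w e" by (metis below_iff)
  moreover have "e \<in> C" using * assms cvxD e_def by metis
  ultimately show "\<exists>c\<in>C. below a w c" by blast
qed

definition halfspace :: "'x set \<Rightarrow> bool" where
  "halfspace H \<longleftrightarrow> cvx H \<and> cvx (- H)"

text \<open>An explicit form of the Pasch--Peano property: \<open>z\<close> lies both between \<open>b\<close> and \<open>b'\<close> and in the
  convex hull of \<open>r\<close>, \<open>h\<close>, \<open>h'\<close>.\<close>
lemma peano_identity:
  assumes r: "below p r q" and b: "below p b h" and b': "below q b' h'"
  defines "z \<equiv> m b b' (m r h h')"
  shows "below r z (m h z h')"
proof -
  define t where "t = m r h h'"
  \<comment> \<open>The meet of \<open>r\<close>, \<open>h\<close> and \<open>h'\<close> read from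
    \<open>z\<close>; the conclusion amounts to \<open>k = z\<close>.\<close>
  define k where "k = m z r (m z h h')"
  have bt: "m z b t = z" "m z b' t = z"
    unfolding z_def t_def[symmetric] by (metis below_iff median_between)+
  have "below z (m z p h) b" "below z (m z q h') b'"
    using b b' meet_below_between by blast+
  have kt: "below z k t"
  proof -
    have "below z (m z r h) t"
      unfolding t_def by (simp add: meet_below_between)
    then show ?thesis
      unfolding k_def by (metis meet_assoc below_meet(1) below_trans)
  qed
  have kh: "below z k h" "below z k h'" "below z k r"
    unfolding k_def by (meson below_meet below_trans)+
  have "below z (m z p k) (m z b t)"
    by (meson kh kt \<open>below z (m z p h) b\<close> below_meet below_meetI below_trans)
  then have "below k z p"
    using bt by (metis below_bot_unique below_iff(3) below_iff(5) swap23)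
  have "below z (m z q k) (m z b' t)"
    by (meson kh kt \<open>below z (m z q h') b'\<close> below_meet below_meetI below_trans)
  then have "below k z q"
    using bt by (metis below_bot_unique below_iff(3) below_iff(5) swap23)
  have "below k z r"
    using below_meetI[OF \<open>below k z p\<close> \<open>below k z q\<close>] meet_below_between[OF r] below_trans by blast
  then have "k = z" using kh(3) by (metis below_iff(3,4) swap23 below_def)
  then show ?thesis unfolding k_def by (metis below_iff(3,5) swap12 swap23)
qed

text \<open>Zorn's lemma yields a maximal convex \<open>H\<close> around \<open>A\<close> that
  avoids \<open>B\<close>. If some \<open>r\<close> in \<open>H\<close> lay between outside points
  \<open>p\<close> and \<open>q\<close>, the point of \<open>peano_identity\<close> would belong to
  both \<open>H\<close> and \<open>B\<close>.\<close>

lemma kakutani_separation: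
  assumes "cvx A" "cvx B" "A \<inter> B = {}"
  shows "\<exists>H. halfspace H \<and> A \<subseteq> H \<and> H \<inter> B = {}"
proof -
  define \<C> where "\<C> = {C. cvx C \<and> A \<subseteq> C \<and> C \<inter> B = {}}"
  have "\<exists>U\<in>\<C>. \<forall>X\<in>\<C>. U \<subseteq> X \<longrightarrow> X = U"
  proof (rule subset_Zorn_nonempty)
    show "\<C> \<noteq> {}" using assms by (auto simp: \<C>_def)
    fix \<D> assume "\<D> \<noteq> {}" and "subset.chain \<C> \<D>"
    then have D: "\<D> \<subseteq> \<C>" "\<And>X Y. X \<in> \<D> \<Longrightarrow> Y \<in> \<D> \<Longrightarrow> X \<subseteq> Y \<or> Y \<subseteq> X"
      by (auto simp: subset_chain_def)
    have "cvx (\<Union>\<D>)"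
    proof (rule cvxI)
      fix a b x assume "a \<in> \<Union>\<D>" "b \<in> \<Union>\<D>"
      then obtain Z where "Z \<in> \<D>" "a \<in> Z" "b \<in> Z" using D(2) by blast
      then show "m a x b \<in> \<Union>\<D>" using D(1) cvxD unfolding \<C>_def by blast
    qed
    then show "\<Union>\<D> \<in> \<C>" using D(1) \<open>\<D> \<noteq> {}\<close> unfolding \<C>_def by blast
  qed
  then obtain H where H: "cvx H" "A \<subseteq> H" "H \<inter> B = {}"
    and max: "\<And>X. cvx X \<Longrightarrow> A \<subseteq> X \<Longrightarrow> X \<inter> B = {} \<Longrightarrow> H \<subseteq> X \<Longrightarrow> X = H"
    unfolding \<C>_def by auto
  \<comment> \<open>By maximality, the join of an outside point with \<open>H\<close>, which is
    convex and strictly larger, must hit \<open>B\<close>.\<close>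
  have meets: "\<exists>h\<in>H. \<exists>b\<in>B. below p b h" if "p \<notin> H" "h0 \<in> H" for p h0
  proof (rule ccontr)
    assume no: "\<not> ?thesis"
    define K where "K = {x. \<exists>c\<in>H. below p x c}"
    have "cvx K" "H \<subseteq> K" unfolding K_def using cvx_join_point H(1) below_refl by blast+
    moreover have "K \<inter> B = {}" using no unfolding K_def by blast
    ultimately have "K = H" using max H(2) by auto
    moreover have "p \<in> K" unfolding K_def using that below_bot by blast
    ultimately show False using that by auto
  qed
  have "cvx (- H)"
    unfolding cvx_iff_below
  proof (intro ballI allI impI ComplI)
    fix p q r assume pq: "p \<in> - H" "q \<in> - H" "below p r q" and "r \<in> H"
    obtain h b where hb: "h \<in> H" "b \<in> B" "below p b h" using meets pq \<open>r \<in> H\<close> by blast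
    obtain h' b' where hb': "h' \<in> H" "b' \<in> B" "below q b' h'" using meets pq \<open>r \<in> H\<close> by blast
    define z where "z = m b b' (m r h h')"
    have "m h z h' \<in> H" using cvxD(1)[OF H(1)] hb hb' by blast
    then have "z \<in> H"
      using peano_identity[OF pq(3) hb(3) hb'(3)] cvx_below[OF H(1) \<open>r \<in> H\<close>]
      unfolding z_def by blast
    moreover have "z \<in> B" unfolding z_def using cvxD(3)[OF assms(2)] hb hb' by blast
    ultimately show False using H by auto
  qed
  then show ?thesis using H unfolding halfspace_def by auto
qed

lemma cvx_singleton [simp]: "cvx {a}"
  by (simp add: cvx_def)

text \<open>Halfspaces are the median homomorphisms to the two-point algebra. Together with
  \<open>eqI_halfspace\<close> this turns an identity between medians into a Boolean one.\<close>

lemma mem_halfspace_median: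
  assumes "halfspace H"
  shows "m a b c \<in> H \<longleftrightarrow> (a \<in> H \<and> b \<in> H) \<or> (b \<in> H \<and> c \<in> H) \<or> (a \<in> H \<and> c \<in> H)"
  using assms cvxD unfolding halfspace_def by (meson ComplD ComplI)

lemma eqI_halfspace:
  assumes "\<And>H. halfspace H \<Longrightarrow> a \<in> H \<longleftrightarrow> b \<in> H"
  shows "a = b"
  using kakutani_separation[of "{a}" "{b}"] assms by auto

end


section \<open>Cubes and the Caratheodory number\<close>

context median_algebra
begin

text \<open>In the interval \<open>[x, y]\<close>, viewed as a distributive lattice, the projections of the points \<open>z i\<close>
  become the atoms of a Boolean algebra once their pairwise meets are joined to the bottom.\<close>
lemma cube_embeds_of_crossing:
  assumes H: "\<And>i. i < k \<Longrightarrow> halfspace (H i)"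
    and x: "\<And>i. i < k \<Longrightarrow> x \<notin> H i" and y: "\<And>i. i < k \<Longrightarrow> y \<in> H i"
    and z: "\<And>i j. i < k \<Longrightarrow> j < k \<Longrightarrow> z i \<in> H j \<longleftrightarrow> i = j"
  shows "cube_embeds k m"
proof -
  \<comment> \<open>\<open>w i\<close> projects \<open>z i\<close> into the interval from
    \<open>x\<close> to \<open>y\<close>, and \<open>J\<close> is the join of a list in that
    lattice, whose bottom is \<open>x\<close>.\<close>
  define w where "w i = m x (z i) y" for i
  define J where "J us = foldr (m y) us x" for us
  define pts where "pts = concat (map (\<lambda>i. map (\<lambda>j. m x (w i) (w j)) (filter (\<lambda>j. i \<noteq> j) [0..<k])) [0..<k])"
  define f where "f u = J (map w (filter u [0..<k]) @ pts)" for u :: "nat \<Rightarrow> bool"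
  \<comment> \<open>How a halfspace \<open>K\<close> sees a join depends only on which of
    \<open>x\<close> and \<open>y\<close> it contains: the four cases read "some", "all", "always"
    and "never".\<close>
  have J1: "J us \<in> K \<longleftrightarrow> (\<exists>u\<in>set us. u \<in> K)" if "halfspace K" "x \<notin> K" "y \<in> K" for K us
    unfolding J_def using that by (induction us) (auto simp: mem_halfspace_median)
  have J2: "J us \<in> K \<longleftrightarrow> (\<forall>u\<in>set us. u \<in> K)" if "halfspace K" "x \<in> K" "y \<notin> K" for K us
    unfolding J_def using that by (induction us) (auto simp: mem_halfspace_median)
  have J3: "J us \<in> K" if "halfspace K" "x \<in> K" "y \<in> K" "set us \<subseteq> K" for K us
    unfolding J_def using that by (induction us) (auto simp: mem_halfspace_median)
  have J4: "J us \<notin> K" if "halfspace K" "x \<notin> K" "y \<notin> K" "set us \<subseteq> - K" for K us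
    unfolding J_def using that by (induction us) (auto simp: mem_halfspace_median)
  have pts: "set pts = (\<Union>i<k. \<Union>j\<in>{..<k} - {i}. {m x (w i) (w j)})"
    unfolding pts_def by auto
  have pts_ex: "(\<exists>v\<in>set pts. P v) \<longleftrightarrow> (\<exists>i<k. \<exists>j<k. i \<noteq> j \<and> P (m x (w i) (w j)))" for P
    unfolding pts by blast
  have pts_all: "(\<forall>v\<in>set pts. P v) \<longleftrightarrow> (\<forall>i<k. \<forall>j<k. i \<noteq> j \<longrightarrow> P (m x (w i) (w j)))" for P
    unfolding pts by blast
  have f1: "f u \<in> K \<longleftrightarrow> (\<exists>i<k. u i \<and> w i \<in> K) \<or> (\<exists>i<k. \<exists>j<k. i \<noteq> j \<and> w i \<in> K \<and> w j \<in> K)"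
    if "halfspace K" "x \<notin> K" "y \<in> K" for K u
    unfolding f_def J1[OF that] set_append bex_Un pts_ex
    using that by (auto simp: mem_halfspace_median)
  have f2: "f u \<in> K \<longleftrightarrow> (\<forall>i<k. u i \<longrightarrow> w i \<in> K) \<and> (\<forall>i<k. \<forall>j<k. i \<noteq> j \<longrightarrow> w i \<in> K \<or> w j \<in> K)"
    if "halfspace K" "x \<in> K" "y \<notin> K" for K u
    unfolding f_def J2[OF that] set_append ball_Un pts_all
    using that by (auto simp: mem_halfspace_median)
  have f3: "f u \<in> K" if "halfspace K" "x \<in> K" "y \<in> K" for K u
    unfolding f_def using that by (intro J3) (auto simp: pts mem_halfspace_median w_def)
  have f4: "f u \<notin> K" if "halfspace K" "x \<notin> K" "y \<notin> K" for K u
    unfolding f_def using that by (intro J4) (auto simp: pts mem_halfspace_median w_def)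
  have wH: "w i \<in> H j \<longleftrightarrow> i = j" if "i < k" "j < k" for i j
    unfolding w_def using that x y z H by (simp add: mem_halfspace_median)
  have fH: "f u \<in> H i \<longleftrightarrow> u i" if "i < k" for u i
    using that x y H wH by (auto simp: f1)
  have "inj_on f (cube k)"
  proof (rule inj_onI)
    fix u v assume uv: "u \<in> cube k" "v \<in> cube k" "f u = f v"
    have "u i = v i" if "i < k" for i
      using fH[OF that, of u] fH[OF that, of v] uv(3) by simp
    moreover have "u i = v i" if "\<not> i < k" for i
      using uv that by (simp add: cube_def PiE_def extensional_def)
    ultimately show "u = v" by blast
  qed
  moreover have "f (cube_median k u v t) = m (f u) (f v) (f t)" for u v t
  proof (rule eqI_halfspace)
    fix K assume K: "halfspace K"
    have maj: "cube_median k u v t i \<longleftrightarrow> u i \<and> v i \<or> v i \<and> t i \<or> u i \<and> t i" if "i < k" for i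
      using that by (auto simp: cube_median_def)
    consider "x \<in> K" "y \<in> K" | "x \<notin> K" "y \<notin> K" | "x \<notin> K" "y \<in> K" | "x \<in> K" "y \<notin> K"
      by blast
    then show "f (cube_median k u v t) \<in> K \<longleftrightarrow> m (f u) (f v) (f t) \<in> K"
    proof cases
      case 3
      show ?thesis
      proof (cases "\<exists>i<k. \<exists>j<k. i \<noteq> j \<and> w i \<in> K \<and> w j \<in> K")
        case True
        then show ?thesis using K 3 by (simp add: mem_halfspace_median f1)
      next
        case False
        \<comment> \<open>At most one \<open>w i\<close> is left in \<open>K\<close>, so membership
          of \<open>f s\<close> is one coordinate of \<open>s\<close> or constantly false, and both
          commute with majority.\<close>
        then have *: "f s \<in> K \<longleftrightarrow> (\<exists>i<k. s i \<and> w i \<in> K)" for s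
          unfolding f1[OF K 3] using False by blast
        show ?thesis
        proof (cases "\<exists>i<k. w i \<in> K")
          case True
          then obtain i where "i < k" "w i \<in> K" by auto
          then have "f s \<in> K \<longleftrightarrow> s i" for s using * False by metis
          then show ?thesis using K \<open>i < k\<close> by (simp add: mem_halfspace_median maj)
        qed (use K * in \<open>auto simp: mem_halfspace_median\<close>)
      qed
    next
      case 4
      show ?thesis
      proof (cases "\<forall>i<k. \<forall>j<k. i \<noteq> j \<longrightarrow> w i \<in> K \<or> w j \<in> K")
        case False
        then have "f s \<notin> K" for s unfolding f2[OF K 4] by blast
        then show ?thesis using K by (simp add: mem_halfspace_median)
      next
        case True
        then have *: "f s \<in> K \<longleftrightarrow> (\<forall>i<k. s i \<longrightarrow> w i \<in> K)" for s
          unfolding f2[OF K 4] using True by blast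
        show ?thesis
        proof (cases "\<exists>i<k. w i \<notin> K")
          case True
          then obtain i where "i < k" "w i \<notin> K" by auto
          then have "f s \<in> K \<longleftrightarrow> \<not> s i" for s
            using * \<open>\<forall>i<k. \<forall>j<k. i \<noteq> j \<longrightarrow> w i \<in> K \<or> w j \<in> K\<close> by metis
          then show ?thesis using K \<open>i < k\<close> by (auto simp: mem_halfspace_median maj)
        qed (use K * in \<open>auto simp: mem_halfspace_median\<close>)
      qed
    qed (use K in \<open>auto simp: mem_halfspace_median f3 f4\<close>)
  qed
  ultimately show ?thesis unfolding cube_embeds_def by blast
qed

lemma cube_embeds_le_rank:
  assumes "median_rank m = enat n" "cube_embeds k m"
  shows "k \<le> n"
proof -
  have "enat k \<le> median_rank m"
    unfolding median_rank_def using assms(2) by (intro SUP_upper) auto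
  then show ?thesis using assms(1) by simp
qed

section \<open>Convex hulls as iterated unions of intervals\<close>

lemma cvx_hull [simp]: "cvx (cvx hull S)"
  by (rule hull_in) (auto simp: cvx_def)

definition join_step :: "'x set \<Rightarrow> 'x set" where
  "join_step S = {x. \<exists>a\<in>S. \<exists>b\<in>S. below a x b}"

lemma join_stepI: "a \<in> S \<Longrightarrow> b \<in> S \<Longrightarrow> below a x b \<Longrightarrow> x \<in> join_step S"
  unfolding join_step_def by blast

lemma subset_join_step: "S \<subseteq> join_step S"
  using join_stepI by fastforce

lemma join_step_mono: "S \<subseteq> T \<Longrightarrow> join_step S \<subseteq> join_step T"
  unfolding join_step_def by blast

lemma join_step_cvx: "cvx C \<Longrightarrow> join_step C = C"
  using subset_join_step[of C] unfolding join_step_def cvx_iff_below by blast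

lemma subset_join_pow: "S \<subseteq> (join_step ^^ k) S"
  by (induction k) (use subset_join_step in force)+

text \<open>Each further point costs one round of intervals, because the join of a point with a hull
  is convex already.\<close>

lemma hull_finite_subset_join_pow:
  assumes "finite A" "A \<subseteq> S"
  shows "cvx hull A \<subseteq> (join_step ^^ card A) S"
  using assms
proof (induction A rule: finite_induct)
  case empty
  have "cvx hull {} \<subseteq> {}" by (rule hull_minimal) (auto simp: cvx_def)
  then show ?case by blast
next
  case (insert a A)
  let ?T = "(join_step ^^ card A) S"
  \<comment> \<open>Inserting \<open>a\<close> separately matters only when the hull of
    \<open>A\<close> is empty.\<close>
  define C where "C = insert a {x. \<exists>c\<in>cvx hull A. below a x c}"
  have "cvx C"
  proof (cases "cvx hull A = {}")
    case False
    then have "C = {x. \<exists>c\<in>cvx hull A. below a x c}" unfolding C_def by force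
    then show ?thesis using cvx_join_point by simp
  qed (simp add: C_def)
  moreover have "insert a A \<subseteq> C" unfolding C_def using hull_subset[of A cvx] below_refl by blast
  ultimately have "cvx hull (insert a A) \<subseteq> C" by (simp add: hull_minimal)
  also have "C \<subseteq> join_step ?T"
  proof -
    have "a \<in> ?T" "cvx hull A \<subseteq> ?T" using insert subset_join_pow by auto
    then show ?thesis unfolding C_def using subset_join_step join_stepI by blast
  qed
  finally show ?case using insert by simp
qed

lemma hull_finitary:
  assumes "x \<in> cvx hull S"
  shows "\<exists>A. finite A \<and> A \<subseteq> S \<and> x \<in> cvx hull A"
proof -
  let ?D = "{x. \<exists>A. finite A \<and> A \<subseteq> S \<and> x \<in> cvx hull A}"
  have "cvx ?D"
  proof (rule cvxI)
    fix a b t assume "a \<in> ?D" "b \<in> ?D"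
    then obtain A B where *: "finite A" "A \<subseteq> S" "a \<in> cvx hull A" "finite B" "B \<subseteq> S" "b \<in> cvx hull B"
      by blast
    then have "a \<in> cvx hull (A \<union> B)" "b \<in> cvx hull (A \<union> B)"
      by (meson hull_mono sup_ge1 sup_ge2 subsetD)+
    then have "m a t b \<in> cvx hull (A \<union> B)" using cvxD(1)[OF cvx_hull] by blast
    then show "m a t b \<in> ?D"
      using * by (intro CollectI exI[of _ "A \<union> B"]) auto
  qed
  moreover have "S \<subseteq> ?D"
  proof
    fix s assume "s \<in> S"
    then show "s \<in> ?D" by (intro CollectI exI[of _ "{s}"]) (auto intro: hull_inc)
  qed
  ultimately have "cvx hull S \<subseteq> ?D" by (rule hull_minimal[rotated])
  then show ?thesis using assms by blast
qed

text \<open>A minimal representation yields pairwise crossing halfspaces, each containing exactly one of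
  the points.\<close>
lemma hull_caratheodory:
  assumes "median_rank m = enat n" "x \<in> cvx hull S"
  shows "\<exists>A. finite A \<and> A \<subseteq> S \<and> card A \<le> max 2 n \<and> x \<in> cvx hull A"
proof -
  define P where "P A \<longleftrightarrow> finite A \<and> A \<subseteq> S \<and> x \<in> cvx hull A" for A
  obtain A0 where "P A0" using hull_finitary[OF assms(2)] unfolding P_def by blast
  then obtain A where A: "P A" and min: "\<And>B. P B \<Longrightarrow> card A \<le> card B"
    using ex_has_least_nat[of P A0 card] by blast
  have "card A \<le> max 2 n"
  proof (rule ccontr)
    assume "\<not> ?thesis"
    then have large: "card A \<ge> 3" "card A > n" by auto
    have "\<exists>H. halfspace H \<and> x \<in> H \<and> a \<in> H \<and> H \<inter> (A - {a}) = {}" if "a \<in> A" for a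
    proof -
      have "finite A" using A P_def by blast
      have "x \<notin> cvx hull (A - {a})"
      proof
        assume "x \<in> cvx hull (A - {a})"
        then have "P (A - {a})" using A unfolding P_def by auto
        then show False using min card_Diff1_less[OF \<open>finite A\<close> that] by (meson not_le)
      qed
      then obtain H where H: "halfspace H" "x \<in> H" "H \<inter> (cvx hull (A - {a})) = {}"
        using kakutani_separation[of "{x}" "cvx hull (A - {a})"] by auto
      have disj: "H \<inter> (A - {a}) = {}" using H(3) hull_subset[of "A - {a}" cvx] by blast
      have "a \<in> H"
      proof (rule ccontr)
        assume "a \<notin> H"
        then have "cvx hull A \<subseteq> - H"
          using H(1) disj by (intro hull_minimal) (auto simp: halfspace_def)
        then show False using A H(2) unfolding P_def by auto
      qed
      then show ?thesis using H disj by blast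
    qed
    then obtain H where H: "\<And>a. a \<in> A \<Longrightarrow> halfspace (H a) \<and> x \<in> H a \<and> a \<in> H a \<and> H a \<inter> (A - {a}) = {}"
      by metis
    \<comment> \<open>The 2 in the bound provides three points. Each \<open>H a\<close> contains at
      most one of them, so their median lies outside all \<open>H a\<close> and serves as the bottom
      of the cube.\<close>
    obtain T where "T \<subseteq> A" "card T = 3" using large obtain_subset_with_card_n by metis
    then obtain a b c where abc: "a \<in> A" "b \<in> A" "c \<in> A" "a \<noteq> b" "b \<noteq> c" "a \<noteq> c"
      using card_3_iff by (metis insert_subset)
    obtain z where z: "bij_betw z {..<card A} A"
      using ex_bij_betw_nat_finite[of A] A unfolding P_def atLeast0LessThan by blast
    have "cube_embeds (card A) m"
    proof (rule cube_embeds_of_crossing[where H = "\<lambda>i. H (z i)" and y = x and x = "m a b c" and z = z])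
      show "halfspace (H (z i))" "x \<in> H (z i)" "m a b c \<notin> H (z i)" if "i < card A" for i
      proof -
        have zi: "z i \<in> A" using z that by (auto simp: bij_betw_def)
        show "halfspace (H (z i))" "x \<in> H (z i)" using H[OF zi] by auto
        then show "m a b c \<notin> H (z i)"
          using H[OF zi] abc by (subst mem_halfspace_median) blast+
      qed
      show "z i \<in> H (z j) \<longleftrightarrow> i = j" if "i < card A" "j < card A" for i j
      proof -
        have "z i \<in> A" "z j \<in> A" "z i = z j \<longleftrightarrow> i = j"
          using z that by (auto simp: bij_betw_def inj_on_def)
        then show ?thesis using H[of "z j"] by auto
      qed
    qed
    from cube_embeds_le_rank[OF assms(1) this] show False using large by auto
  qed
  then show ?thesis using A P_def by blast
qed

text \<open>This is what finite rank buys for the topology: the number of rounds does not depend on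
  \<open>S\<close>, so that \<open>join_pow_nbhd\<close> can control whole hulls.\<close>

lemma hull_subset_join_pow:
  assumes "median_rank m = enat n"
  shows "cvx hull S \<subseteq> (join_step ^^ max 2 n) S"
proof
  fix x assume "x \<in> cvx hull S"
  then obtain A where A: "finite A" "A \<subseteq> S" "card A \<le> max 2 n" "x \<in> cvx hull A"
    using hull_caratheodory[OF assms] by blast
  have "x \<in> (join_step ^^ card A) S" using hull_finite_subset_join_pow A by blast
  also have "\<dots> \<subseteq> (join_step ^^ (max 2 n - card A)) ((join_step ^^ card A) S)"
    by (rule subset_join_pow)
  also have "\<dots> = (join_step ^^ max 2 n) S"
    using A(3) by (simp flip: funpow_add comp_apply[of "join_step ^^ _"])
  finally show "x \<in> (join_step ^^ max 2 n) S" .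
qed

end


section \<open>Separation by continuous functions\<close>

lemma dyadic_between:
  fixes a b :: real
  assumes "0 \<le> a" "a < b"
  shows "\<exists>r\<in>dyadics. a < r \<and> r < b"
proof -
  obtain n where n: "1 / (b - a) < 2 ^ n"
    using real_arch_pow[of 2] by auto
  define q where "q = nat \<lfloor>2 ^ n * a\<rfloor> + 1"
  have "real q = of_int \<lfloor>2 ^ n * a\<rfloor> + 1" using assms by (simp add: q_def)
  then have "2 ^ n * a < real q" "real q \<le> 2 ^ n * a + 1" by linarith+
  moreover have "1 < 2 ^ n * b - 2 ^ n * a" using n assms by (simp add: field_simps)
  ultimately have "a < real q / 2 ^ n" "real q / 2 ^ n < b" by (simp_all add: field_simps)
  then show ?thesis unfolding dyadics_def by blast
qed

context median_algebra
begin

lemma halfspace_Union_chain: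
  assumes "\<And>H. H \<in> \<H> \<Longrightarrow> halfspace H" "\<And>H K. H \<in> \<H> \<Longrightarrow> K \<in> \<H> \<Longrightarrow> H \<subseteq> K \<or> K \<subseteq> H"
  shows "halfspace (\<Union>\<H>)"
  unfolding halfspace_def
proof
  show "cvx (\<Union>\<H>)"
  proof (rule cvxI)
    fix a b x assume "a \<in> \<Union>\<H>" "b \<in> \<Union>\<H>"
    then obtain H where "H \<in> \<H>" "a \<in> H" "b \<in> H" using assms(2) by blast
    then show "m a x b \<in> \<Union>\<H>" using assms(1)[of H] mem_halfspace_median[of H a x b] by blast
  qed
  show "cvx (- \<Union>\<H>)"
  proof (rule cvxI)
    fix a b x assume *: "a \<in> - \<Union>\<H>" "b \<in> - \<Union>\<H>"
    have "m a x b \<notin> H" if "H \<in> \<H>" for H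
      using that * assms(1)[OF that] mem_halfspace_median[of H a x b] by blast
    then show "m a x b \<in> - \<Union>\<H>" by blast
  qed
qed

lemma halfspace_UNIV [simp]: "halfspace UNIV"
  by (simp add: halfspace_def cvx_def)

end

lemma Wallace_open:
  fixes K :: "'a::topological_space set" and L :: "'b::topological_space set"
  assumes "compact K" "compact L" "open W" "K \<times> L \<subseteq> W"
  obtains U V where "open U" "open V" "K \<subseteq> U" "L \<subseteq> V" "U \<times> V \<subseteq> W"
  using Wallace_theorem_prod_topology[of euclidean K euclidean L W] assms by auto

section \<open>Neighbourhoods of closed convex sets\<close>

context compact_median_algebra
begin

lemma compact_closed: "closed (S :: 'x set) \<Longrightarrow> compact S"
  using compact closed_Int_compact[of S UNIV] by simp

lemma cvx_closure:
  assumes "cvx C"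
  shows "cvx (closure C)"
proof (rule cvxI)
  fix a b x assume ab: "a \<in> closure C" "b \<in> closure C"
  have "continuous_on UNIV ((\<lambda>(a, b, c). m a b c) \<circ> (\<lambda>(a, b). (a, x, b)))"
    by (intro continuous_on_compose continuous_on_subset[OF continuous])
      (auto simp: case_prod_unfold intro!: continuous_intros)
  then have "continuous_on (closure (C \<times> C)) (\<lambda>(a, b). m a x b)"
    by (auto simp: o_def case_prod_unfold intro: continuous_on_subset)
  moreover have "(\<lambda>(a, b). m a x b) ` (C \<times> C) \<subseteq> closure C"
    using assms closure_subset[of C] cvxD(1) by fastforce
  ultimately have "(\<lambda>(a, b). m a x b) ` closure (C \<times> C) \<subseteq> closure C"
    by (intro image_closure_subset) auto
  then show "m a x b \<in> closure C" using ab by (auto simp: closure_Times)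
qed

text \<open>Compactness enters twice: first to find a neighbourhood of \<open>C \<times> C\<close>
  that works for all \<open>x\<close> at once, then to fit a product of two neighbourhoods of
  \<open>C\<close> into it.\<close>

lemma join_step_nbhd:
  assumes "closed C" "open U" "join_step C \<subseteq> U"
  shows "\<exists>W. open W \<and> C \<subseteq> W \<and> join_step W \<subseteq> U"
proof -
  define P where "P = (\<lambda>(x, a, b). m a x b) -` U"
  have "continuous_on UNIV ((\<lambda>(a, b, c). m a b c) \<circ> (\<lambda>(x, a, b). (a, x, b)))"
    by (intro continuous_on_compose continuous_on_subset[OF continuous])
      (auto simp: case_prod_unfold intro!: continuous_intros)
  then have "open P" unfolding P_def using assms(2)
    by (intro open_vimage) (auto simp: o_def case_prod_unfold)
  have "compact (C \<times> C)" using assms(1) compact_closed by (simp add: compact_Times)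
  have "m a x b \<in> U" if "a \<in> C" "b \<in> C" for a b x
    using assms(3) join_stepI[OF that median_between(2)] by blast
  then have "UNIV \<times> (C \<times> C) \<subseteq> P"
    unfolding P_def by auto
  then obtain V where V: "open V" "C \<times> C \<subseteq> V" "UNIV \<times> V \<subseteq> P"
    using Wallace_open[OF compact \<open>compact (C \<times> C)\<close> \<open>open P\<close>] by (metis top.extremum_uniqueI)
  obtain W1 W2 where W: "open W1" "open W2" "C \<subseteq> W1" "C \<subseteq> W2" "W1 \<times> W2 \<subseteq> V"
    using Wallace_open[OF compact_closed[OF assms(1)] compact_closed[OF assms(1)] V(1,2)] .
  have "join_step (W1 \<inter> W2) \<subseteq> U"
  proof
    fix x assume "x \<in> join_step (W1 \<inter> W2)"
    then obtain a b where ab: "a \<in> W1" "b \<in> W2" "below a x b" unfolding join_step_def by blast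
    then have "(x, a, b) \<in> P" using V W by blast
    then show "x \<in> U" unfolding P_def using ab(3) by (simp add: below_def)
  qed
  then show ?thesis using W by (intro exI[of _ "W1 \<inter> W2"]) auto
qed

text \<open>A convex set is a fixed point of \<open>join_step\<close>, so the one-step statement can
  be repeated. \<open>W\<close> shrinks with \<open>k\<close>, hence the need for a bound on the
  number of rounds.\<close>

lemma join_pow_nbhd:
  assumes "closed C" "cvx C" "open U" "C \<subseteq> U"
  shows "\<exists>W. open W \<and> C \<subseteq> W \<and> (join_step ^^ k) W \<subseteq> U"
proof (induction k)
  case 0
  then show ?case using assms by auto
next
  case (Suc k)
  then obtain W where W: "open W" "C \<subseteq> W" "(join_step ^^ k) W \<subseteq> U" by blast
  have "join_step C \<subseteq> W" using join_step_cvx[OF assms(2)] W by auto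
  then obtain W' where W': "open W'" "C \<subseteq> W'" "join_step W' \<subseteq> W"
    using join_step_nbhd[OF assms(1) W(1)] by blast
  have "mono (join_step ^^ k)" by (intro mono_pow monoI join_step_mono)
  then have "(join_step ^^ Suc k) W' \<subseteq> (join_step ^^ k) W"
    using W'(3) by (simp add: funpow_Suc_right monoD del: funpow.simps)
  then show ?case using W W' by blast
qed

end

section \<open>Urysohn functions made of halfspaces\<close>

locale finite_rank_compact_median_algebra = compact_median_algebra m
  for m :: "'x::t2_space \<Rightarrow> 'x \<Rightarrow> 'x \<Rightarrow> 'x" +
  fixes n :: nat
  assumes rank: "median_rank m = enat n"
begin

text \<open>Kakutani's halfspaces carry no topological information. Applied to hulls of open
  neighbourhoods instead of \<open>C\<close> and \<open>D\<close> themselves, the separation leaves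
  room on both sides, as a Urysohn argument requires.\<close>

lemma closed_cvx_separation:
  assumes "closed C" "closed D" "cvx C" "cvx D" "C \<inter> D = {}"
  shows "\<exists>H. halfspace H \<and> C \<subseteq> interior H \<and> closure H \<inter> D = {}"
proof -
  have sub: "C \<times> D \<subseteq> {p. fst p \<noteq> snd p}" using assms(5) by auto
  have op: "open {p :: 'x \<times> 'x. fst p \<noteq> snd p}"
    using open_diagonal_complement by (simp add: case_prod_unfold)
  obtain U V where UV: "open U" "open V" "C \<subseteq> U" "D \<subseteq> V" "U \<times> V \<subseteq> {p. fst p \<noteq> snd p}"
    using Wallace_open[OF compact_closed[OF assms(1)] compact_closed[OF assms(2)] op sub] .
  obtain C' where C': "open C'" "C \<subseteq> C'" "cvx hull C' \<subseteq> U"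
    using join_pow_nbhd[OF assms(1,3) UV(1,3), of "max 2 n"] hull_subset_join_pow[OF rank] by blast
  obtain D' where D': "open D'" "D \<subseteq> D'" "cvx hull D' \<subseteq> V"
    using join_pow_nbhd[OF assms(2,4) UV(2,4), of "max 2 n"] hull_subset_join_pow[OF rank] by blast
  have "cvx hull C' \<inter> cvx hull D' = {}" using C'(3) D'(3) UV(5) by fastforce
  then obtain H where H: "halfspace H" "cvx hull C' \<subseteq> H" "H \<inter> cvx hull D' = {}"
    using kakutani_separation[of "cvx hull C'" "cvx hull D'"] by auto
  have sub: "C' \<subseteq> cvx hull C'" "D' \<subseteq> cvx hull D'" by (rule hull_subset)+
  have "C' \<subseteq> interior H" using sub H(2) C'(1) by (intro interior_maximal) auto
  moreover have "closure H \<subseteq> - D'"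
    using sub H(3) D'(1) by (intro closure_minimal) auto
  ultimately show ?thesis using H C' D' by blast
qed

lemma point_separation:
  assumes "a \<noteq> b"
  shows "\<exists>H. halfspace H \<and> a \<in> interior H \<and> b \<notin> closure H"
  using closed_cvx_separation[of "{a}" "{b}"] assms by auto

text \<open>On a real interval these are the monotone functions. Strict sublevel sets are used
  because those of a Urysohn function are unions of chains.\<close>

definition halfspace_function :: "('x \<Rightarrow> real) \<Rightarrow> bool" where
  "halfspace_function f \<longleftrightarrow> continuous_on UNIV f \<and> range f \<subseteq> {0..1} \<and> (\<forall>t. halfspace {x. f x < t})"

lemma halfspace_function_separation:
  assumes "a \<noteq> b"
  shows "\<exists>f. halfspace_function f \<and> f a \<noteq> f b"
proof -
  obtain M where M: "halfspace M" "a \<in> interior M" "b \<notin> closure M"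
    using point_separation[OF assms] by blast
  have compl: "closed (- interior K) \<and> cvx (- interior K)" if "halfspace K" for K
    using that cvx_closure[of "- K"] unfolding halfspace_def closure_complement by blast
  \<comment> \<open>The dyadic recursion starts from two nested halfspaces, so a second one is
    inserted between \<open>a\<close> and \<open>M\<close>.\<close>
  obtain M0 where M0: "halfspace M0" "a \<in> interior M0" "closure M0 \<subseteq> interior M"
    using closed_cvx_separation[of "{a}" "- interior M"] compl[OF M(1)] M(2)
    by (auto simp: disjoint_eq_subset_Compl)
  define R where "R H K \<longleftrightarrow> halfspace H \<and> halfspace K \<and> closure H \<subseteq> interior K" for H K
  have "\<exists>G :: real \<Rightarrow> 'x set. G 0 = M0 \<and> G 1 = M \<and>
      (\<forall>x\<in>dyadics \<inter> {0..1}. \<forall>y\<in>dyadics \<inter> {0..1}. x < y \<longrightarrow> R (G x) (G y))"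
  proof (rule recursion_on_dyadic_fractions)
    show "R M0 M" unfolding R_def using M M0 by auto
    show "\<exists>L. R H L \<and> R L K" if HK: "R H K" for H K
    proof -
      have "closed (closure H)" "cvx (closure H)" "closure H \<inter> - interior K = {}"
        using HK cvx_closure unfolding R_def halfspace_def by auto
      then obtain L where "halfspace L" "closure H \<subseteq> interior L" "closure L \<inter> - interior K = {}"
        using closed_cvx_separation[of "closure H" "- interior K"] compl[of K] HK
        unfolding R_def by blast
      then show ?thesis using HK unfolding R_def by blast
    qed
    show "R H L" if "R H K" "R K L" for H K L
      using that interior_subset[of K] closure_subset[of K] unfolding R_def by blast
  qed
  then obtain G :: "real \<Rightarrow> 'x set" where G0: "G 0 = M0" and G1: "G 1 = M"
    and G: "\<And>r s. r \<in> dyadics \<inter> {0..1} \<Longrightarrow> s \<in> dyadics \<inter> {0..1} \<Longrightarrow> r < s \<Longrightarrow> R (G r) (G s)"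
    by blast
  have D01: "0 \<in> dyadics \<inter> {0..1::real}" "1 \<in> dyadics \<inter> {0..1::real}"
    using real_in_dyadics[of 0] real_in_dyadics[of 1] by auto
  \<comment> \<open>\<open>R\<close> compares strictly increasing indices only, so the last set
    \<open>G 1 = M\<close> is treated by itself.\<close>
  have halfG: "halfspace (G r)" if "r \<in> dyadics \<inter> {0..1}" for r
    using that G[OF that D01(2)] G1 M(1) unfolding R_def by (cases "r = 1") auto
  have Gsub: "closure (G r) \<subseteq> interior (G s)"
    if "r \<in> dyadics \<inter> {0..1}" "s \<in> dyadics \<inter> {0..1}" "r < s" for r s
    using G[OF that] unfolding R_def by blast
  then have Gmono: "G r \<subseteq> G s" if "r \<in> dyadics \<inter> {0..1}" "s \<in> dyadics \<inter> {0..1}" "r \<le> s" for r s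
  proof (cases "r = s")
    case False
    then show ?thesis
      using Gsub[OF that(1,2)] that(3) closure_subset[of "G r"] interior_subset[of "G s"] by auto
  qed auto
  \<comment> \<open>The inserted 1 is the value at the points outside all
    \<open>G r\<close>.\<close>
  define f where "f x = Inf (insert 1 {r \<in> dyadics \<inter> {0..1}. x \<in> G r})" for x
  have bdd: "bdd_below (insert 1 {r \<in> dyadics \<inter> {0..1::real}. x \<in> G r})" for x
    by (rule bdd_belowI[of _ 0]) auto
  have f_less: "f x < t \<longleftrightarrow> 1 < t \<or> (\<exists>r\<in>dyadics \<inter> {0..1}. r < t \<and> x \<in> G r)" for x t
    unfolding f_def using bdd by (subst cInf_less_iff) auto
  have f01: "0 \<le> f x" "f x \<le> 1" for x
  proof -
    show "0 \<le> f x" using f_less[of x 0] by force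
    show "f x \<le> 1" unfolding f_def using bdd by (intro cInf_lower) auto
  qed
  have "halfspace {x. f x < t}" for t
  proof (cases "t > 1")
    case True
    then show ?thesis by (simp add: f_less)
  next
    case False
    then have eq: "{x. f x < t} = \<Union>(G ` {r \<in> dyadics \<inter> {0..1}. r < t})"
      by (auto simp: f_less)
    show ?thesis unfolding eq
    proof (rule halfspace_Union_chain)
      fix H K assume "H \<in> G ` {r \<in> dyadics \<inter> {0..1}. r < t}" "K \<in> G ` {r \<in> dyadics \<inter> {0..1}. r < t}"
      then obtain r s where rs: "H = G r" "K = G s" "r \<in> dyadics \<inter> {0..1}" "s \<in> dyadics \<inter> {0..1}"
        by auto
      then show "H \<subseteq> K \<or> K \<subseteq> H" using Gmono[OF rs(3,4)] Gmono[OF rs(4,3)] linear[of r s] by blast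
    qed (use halfG in blast)
  qed
  moreover have "isCont f x" for x
    unfolding isCont_def
  proof (rule order_tendstoI)
    fix t assume t: "t < f x"
    show "\<forall>\<^sub>F y in at x. t < f y"
    proof (cases "t < 0")
      case True
      then show ?thesis using f01(1) by (intro always_eventually) (auto intro: less_le_trans)
    next
      case False
      \<comment> \<open>Below \<open>f x\<close>, the gap between \<open>r\<close> and
        \<open>s\<close> leads from \<open>x \<notin> G s\<close> to the open complement of the
        closure of \<open>G r\<close>; \<open>s'\<close> above \<open>s\<close> is needed because
        \<open>f_less\<close> is strict.\<close>
      then obtain s where s: "s \<in> dyadics" "t < s" "s < f x" using dyadic_between[of t "f x"] t by auto
      obtain r where r: "r \<in> dyadics" "t < r" "r < s" using dyadic_between[of t s] s False by auto
      have rs: "r \<in> dyadics \<inter> {0..1}" "s \<in> dyadics \<inter> {0..1}" using s r f01(2)[of x] False by auto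
      obtain s' where s': "s' \<in> dyadics" "s < s'" "s' < f x" using dyadic_between[of s "f x"] s rs by auto
      have "x \<notin> G s" using f_less[of x s'] s' rs by auto
      then have "x \<in> - closure (G r)" using Gsub[OF rs r(3)] interior_subset[of "G s"] by blast
      moreover have "t < f y" if "y \<in> - closure (G r)" for y
      proof -
        have "y \<notin> G r" using that closure_subset[of "G r"] by blast
        then have "y \<notin> G q" if "q \<in> dyadics \<inter> {0..1}" "q < r" for q
          using Gmono[OF that(1) rs(1)] that(2) by auto
        then have "\<not> f y < r"
          using rs(1) by (auto simp: f_less)
        then show ?thesis using r by linarith
      qed
      ultimately show ?thesis
        by (intro eventually_at_topological[THEN iffD2] exI[of _ "- closure (G r)"]) auto
    qed
  next
    fix t assume t: "f x < t"
    show "\<forall>\<^sub>F y in at x. f y < t"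
    proof (cases "1 < t")
      case True
      then show ?thesis using f01(2) by (intro always_eventually) (auto intro: le_less_trans)
    next
      case False
      then obtain r where r: "r \<in> dyadics \<inter> {0..1}" "r < t" "x \<in> G r" using t by (auto simp: f_less)
      obtain s where s: "s \<in> dyadics" "r < s" "s < t" using dyadic_between[of r t] r by auto
      have s01: "s \<in> dyadics \<inter> {0..1}" using s r False by auto
      have "x \<in> interior (G s)" using Gsub[OF r(1) s01 s(2)] r(3) closure_subset[of "G r"] by blast
      moreover have "f y < t" if "y \<in> interior (G s)" for y
        using s01 s(3) that interior_subset[of "G s"] by (auto simp: f_less)
      ultimately show ?thesis
        by (intro eventually_at_topological[THEN iffD2] exI[of _ "interior (G s)"]) auto
    qed
  qed
  then have "continuous_on UNIV f" by (simp add: continuous_on_eq_continuous_at)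
  ultimately have "halfspace_function f" using f01 unfolding halfspace_function_def by auto
  moreover have "f a \<noteq> f b"
  proof -
    have "a \<in> G 0" using G0 M0(2) interior_subset by blast
    then have "f a < 1" using f_less[of a 1] D01(1) by force
    moreover have "b \<notin> G r" if "r \<in> dyadics \<inter> {0..1}" for r
      using Gmono[OF that D01(2)] that G1 M(3) closure_subset by auto
    then have "\<not> f b < 1" using f_less[of b 1] by auto
    ultimately show ?thesis by simp
  qed
  ultimately show ?thesis by blast
qed

end


section \<open>Polynomially many patterns and Rademacher averages\<close>

definition shatters :: "'a set set \<Rightarrow> 'a set \<Rightarrow> bool" where
  "shatters \<A> S \<longleftrightarrow> (\<forall>T\<subseteq>S. \<exists>A\<in>\<A>. A \<inter> S = T)"

text \<open>Pajor's form of the Sauer-Shelah lemma. Deleting \<open>a\<close> from the members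
  leaves \<open>B \<union> C\<close>, and the sets that coincide after deletion are counted again by
  \<open>B \<inter> C\<close>; whatever \<open>B \<inter> C\<close> shatters is shattered by the
  whole family with \<open>a\<close> added.\<close>

lemma card_le_card_shattered:
  assumes "finite I" "\<A> \<subseteq> Pow I"
  shows "card \<A> \<le> card {S. S \<subseteq> I \<and> shatters \<A> S}"
  using assms
proof (induction I arbitrary: \<A> rule: finite_induct)
  case empty
  then consider "\<A> = {}" | "\<A> = {{}}" by (metis Pow_empty subset_singletonD)
  then show ?case
  proof cases
    case 2
    then have "{S. S \<subseteq> {} \<and> shatters \<A> S} = {{}}" by (auto simp: shatters_def)
    then show ?thesis using 2 by simp
  qed simp
next
  case (insert a I)
  define B where "B = {A\<in>\<A>. a \<notin> A}"
  define B' where "B' = {A\<in>\<A>. a \<in> A}"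
  define C where "C = (\<lambda>A. A - {a}) ` B'"
  have fin: "finite \<A>" using insert.prems insert.hyps(1) finite_subset by fastforce
  then have fins: "finite B" "finite B'" "finite C" by (auto simp: B_def B'_def C_def)
  have sub: "B \<subseteq> Pow I" "C \<subseteq> Pow I" using insert.prems by (auto simp: B_def B'_def C_def)
  have "inj_on (\<lambda>A. A - {a}) B'" by (auto simp: inj_on_def B'_def)
  then have cC: "card C = card B'" unfolding C_def by (rule card_image)
  have "\<A> = B \<union> B'" "B \<inter> B' = {}" by (auto simp: B_def B'_def)
  then have "card \<A> = card B + card C" using fins cC by (simp add: card_Un_disjoint)
  also have "\<dots> = card (B \<union> C) + card (B \<inter> C)" using fins by (intro card_Un_Int)
  also have "\<dots> \<le> card {S. S \<subseteq> I \<and> shatters (B \<union> C) S} + card {S. S \<subseteq> I \<and> shatters (B \<inter> C) S}"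
    using sub by (intro add_mono insert.IH) auto
  also have "\<dots> = card {S. S \<subseteq> I \<and> shatters (B \<union> C) S} + card (insert a ` {S. S \<subseteq> I \<and> shatters (B \<inter> C) S})"
  proof -
    have "inj_on (insert a) {S. S \<subseteq> I \<and> shatters (B \<inter> C) S}"
      using insert.hyps by (intro inj_onI) (metis insert_ident mem_Collect_eq subsetD)
    then show ?thesis by (simp add: card_image)
  qed
  also have "\<dots> = card ({S. S \<subseteq> I \<and> shatters (B \<union> C) S} \<union> insert a ` {S. S \<subseteq> I \<and> shatters (B \<inter> C) S})"
    using insert.hyps by (subst card_Un_disjoint) auto
  also have "\<dots> \<le> card {S. S \<subseteq> insert a I \<and> shatters \<A> S}"
  proof (rule card_mono)
    show "finite {S. S \<subseteq> insert a I \<and> shatters \<A> S}" using insert.hyps by simp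
    have "shatters \<A> S" if S: "S \<subseteq> I" "shatters (B \<union> C) S" for S
      unfolding shatters_def
    proof (intro allI impI)
      fix T assume "T \<subseteq> S"
      then obtain A where A: "A \<in> B \<union> C" "A \<inter> S = T" using S(2) unfolding shatters_def by blast
      have "a \<notin> S" using S insert.hyps by auto
      show "\<exists>A\<in>\<A>. A \<inter> S = T"
      proof (cases "A \<in> B")
        case False
        then obtain A' where A': "A' \<in> \<A>" "A = A' - {a}" using A unfolding C_def B'_def by auto
        then have "A' \<inter> S = T" using A(2) \<open>a \<notin> S\<close> by auto
        then show ?thesis using A' by blast
      qed (use A B_def in auto)
    qed
    moreover have "shatters \<A> (insert a S)" if S: "S \<subseteq> I" "shatters (B \<inter> C) S" for S
      unfolding shatters_def
    proof (intro allI impI)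
      fix T assume "T \<subseteq> insert a S"
      then have "T - {a} \<subseteq> S" by auto
      then obtain A where A: "A \<in> B" "A \<in> C" "A \<inter> S = T - {a}"
        using S(2) unfolding shatters_def by blast
      have "a \<notin> S" using S insert.hyps by auto
      obtain A' where A': "A' \<in> \<A>" "a \<in> A'" "A = A' - {a}" using A unfolding C_def B'_def by auto
      show "\<exists>A\<in>\<A>. A \<inter> insert a S = T"
      proof (cases "a \<in> T")
        case True
        then have "A' \<inter> insert a S = T" using A A' \<open>a \<notin> S\<close> by auto
        then show ?thesis using A' by blast
      next
        case False
        then have "A \<inter> insert a S = T" "A \<in> \<A>" using A unfolding B_def by auto
        then show ?thesis by blast
      qed
    qed
    ultimately show "{S. S \<subseteq> I \<and> shatters (B \<union> C) S} \<union> insert a ` {S. S \<subseteq> I \<and> shatters (B \<inter> C) S}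
        \<subseteq> {S. S \<subseteq> insert a I \<and> shatters \<A> S}"
      by blast
  qed
  finally show ?case .
qed

lemma card_subsets_le:
  assumes "finite I"
  shows "card {S. S \<subseteq> I \<and> card S \<le> n} \<le> (card I + 1) ^ n"
proof (induction n)
  case 0
  have "{S. S \<subseteq> I \<and> card S \<le> 0} = {{}}"
    using assms by (auto dest: finite_subset)
  then show ?case by simp
next
  case (Suc n)
  let ?P = "\<lambda>n. {S. S \<subseteq> I \<and> card S \<le> n}"
  \<comment> \<open>A set of at most \<open>n + 1\<close> elements arises from one of at most
    \<open>n\<close> by adding one element, or none, which is the option
    \<open>None\<close>.\<close>
  let ?J = "insert None (Some ` I)"
  let ?h = "\<lambda>(S, o'). case o' of None \<Rightarrow> S | Some i \<Rightarrow> insert i S"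
  have fin: "finite (?P n \<times> ?J)" using assms by simp
  have "?P (Suc n) \<subseteq> ?h ` (?P n \<times> ?J)"
  proof
    fix S assume S: "S \<in> ?P (Suc n)"
    show "S \<in> ?h ` (?P n \<times> ?J)"
    proof (cases "card S \<le> n")
      case True
      then show ?thesis using S by (intro image_eqI[of _ _ "(S, None)"]) auto
    next
      case False
      then obtain i where "i \<in> S" by fastforce
      then have "S - {i} \<in> ?P n" using S by auto
      then show ?thesis using S \<open>i \<in> S\<close> by (intro image_eqI[of _ _ "(S - {i}, Some i)"]) auto
    qed
  qed
  then have "card (?P (Suc n)) \<le> card (?h ` (?P n \<times> ?J))" using fin by (intro card_mono) auto
  also have "\<dots> \<le> card (?P n \<times> ?J)" using fin by (rule card_image_le)
  also have "\<dots> = card (?P n) * (card I + 1)"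
    using assms by (simp add: card_cartesian_product card_image)
  also have "\<dots> \<le> (card I + 1) ^ n * (card I + 1)" using Suc.IH by (intro mult_right_mono) auto
  finally show ?case by (simp only: power_Suc2)
qed

context median_algebra
begin

text \<open>Points realising the empty, the full and the singleton patterns on a shattered set are
  the \<open>x\<close>, \<open>y\<close> and \<open>z\<close> of
  \<open>cube_embeds_of_crossing\<close>. So shattered sets have at most \<open>n\<close> elements;
  \<open>R\<close> takes one point per pattern.\<close>

lemma halfspace_pattern_net:
  assumes rank: "median_rank m = enat n" and "finite I" and H: "\<And>i. i \<in> I \<Longrightarrow> halfspace (H i)"
  shows "\<exists>R. finite R \<and> card R \<le> (card I + 1) ^ n \<and> (\<forall>x. \<exists>r\<in>R. \<forall>i\<in>I. x \<in> H i \<longleftrightarrow> r \<in> H i)"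
proof -
  define pat where "pat x = {i\<in>I. x \<in> H i}" for x
  have sub: "range pat \<subseteq> Pow I" by (auto simp: pat_def)
  then have fin: "finite (range pat)" using assms(2) finite_subset by blast
  have small: "card S \<le> n" if S: "S \<subseteq> I" "shatters (range pat) S" for S
  proof -
    have "finite S" using S assms(2) finite_subset by blast
    then obtain b where b: "bij_betw b {..<card S} S"
      using ex_bij_betw_nat_finite[of S] by (auto simp: atLeast0LessThan)
    have "\<exists>x. pat x \<inter> S = T" if "T \<subseteq> S" for T
      using S(2) that unfolding shatters_def by blast
    then obtain p where p: "\<And>T. T \<subseteq> S \<Longrightarrow> pat (p T) \<inter> S = T" by metis
    have bS: "b i \<in> S" if "i < card S" for i using b that by (auto simp: bij_betw_def)
    have mem: "p T \<in> H (b i) \<longleftrightarrow> b i \<in> T" if "T \<subseteq> S" "i < card S" for T i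
      using p[OF that(1)] bS[OF that(2)] S(1) unfolding pat_def by blast
    have "cube_embeds (card S) m"
    proof (rule cube_embeds_of_crossing[where H = "\<lambda>i. H (b i)" and x = "p {}" and y = "p S"
          and z = "\<lambda>i. p {b i}"])
      show "halfspace (H (b i))" "p {} \<notin> H (b i)" "p S \<in> H (b i)" if "i < card S" for i
        using that bS[OF that] S(1) H mem by auto
      show "p {b i} \<in> H (b j) \<longleftrightarrow> i = j" if "i < card S" "j < card S" for i j
        using mem[of "{b i}" j] bS that b by (auto simp: bij_betw_def inj_on_def)
    qed
    then show ?thesis using cube_embeds_le_rank[OF rank] by blast
  qed
  have "card (range pat) \<le> card {S. S \<subseteq> I \<and> shatters (range pat) S}"
    by (rule card_le_card_shattered[OF assms(2) sub])
  also have "\<dots> \<le> card {S. S \<subseteq> I \<and> card S \<le> n}"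
    using assms(2) small by (intro card_mono) auto
  also have "\<dots> \<le> (card I + 1) ^ n" by (rule card_subsets_le[OF assms(2)])
  finally have "card (range pat) \<le> (card I + 1) ^ n" .
  then have "card (inv pat ` range pat) \<le> (card I + 1) ^ n"
    using card_image_le[OF fin, of "inv pat"] by linarith
  moreover have "\<exists>r\<in>inv pat ` range pat. \<forall>i\<in>I. x \<in> H i \<longleftrightarrow> r \<in> H i" for x
  proof
    have "pat (inv pat (pat x)) = pat x" by (simp add: f_inv_into_f)
    then show "\<forall>i\<in>I. x \<in> H i \<longleftrightarrow> inv pat (pat x) \<in> H i" unfolding pat_def by blast
  qed simp
  ultimately show ?thesis using fin by blast
qed

end

section \<open>Random signs\<close>

definition rademacher :: "nat set \<Rightarrow> nat \<Rightarrow> real" where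
  "rademacher A i = (if i \<in> A then 1 else -1)"

lemma abs_rademacher [simp]: "\<bar>rademacher A i\<bar> = 1"
  by (simp add: rademacher_def)

text \<open>Independence of the signs. A sign sequence is coded by the set of its plus signs, so a
  sum over \<open>Pow {..<k}\<close> is \<open>2 ^ k\<close> times an expectation, and the identity
  expands a product of two-term sums.\<close>

lemma sum_exp_rademacher:
  "(\<Sum>A\<in>Pow {..<k}. exp (\<Sum>i<k. rademacher A i * y i)) = (\<Prod>i<k. exp (y i) + exp (- y i :: real))"
proof -
  have "exp (\<Sum>i<k. rademacher A i * y i) = (\<Prod>i\<in>A. exp (y i)) * (\<Prod>i\<in>{..<k} - A. exp (- y i))"
    if "A \<in> Pow {..<k}" for A
  proof -
    have "exp (\<Sum>i<k. rademacher A i * y i) = (\<Prod>i<k. exp (rademacher A i * y i))" by (simp add: exp_sum)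
    also have "\<dots> = (\<Prod>i\<in>A. exp (rademacher A i * y i)) * (\<Prod>i\<in>{..<k} - A. exp (rademacher A i * y i))"
      using that prod.subset_diff[of A "{..<k}"] by (simp add: mult.commute)
    finally show ?thesis by (simp add: rademacher_def)
  qed
  then show ?thesis by (subst prod_add) auto
qed

text \<open>The sharp exponent is \<open>y\<^sup>2 / 2\<close>; losing the factor two is harmless
  and lets quadratic bounds on the unit interval suffice.\<close>

lemma exp_add_exp_minus_le:
  fixes y :: real
  assumes "\<bar>y\<bar> \<le> 1"
  shows "exp y + exp (- y) \<le> 2 * exp (y\<^sup>2)"
proof -
  have *: "exp t + exp (- t) \<le> 2 * exp (t\<^sup>2)" if "0 \<le> t" "t \<le> 1" for t :: real
  proof -
    have "exp t \<le> 1 + t + t\<^sup>2" using that by (rule exp_bound)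
    moreover have "exp (- t) \<le> 1 - t + t\<^sup>2"
    proof -
      have "1 / (1 + t) \<ge> exp (- t)" 
        using that exp_ge_add_one_self[of t] by (simp add: exp_minus field_simps)
      moreover have "1 / (1 + t) \<le> 1 - t + t\<^sup>2"
      proof -
        have "(1 - t + t\<^sup>2) * (1 + t) = 1 + t ^ 3" by (simp add: algebra_simps power2_eq_square power3_eq_cube)
        then show ?thesis using that by (simp add: pos_divide_le_eq)
      qed
      ultimately show ?thesis by linarith
    qed
    moreover have "1 + t\<^sup>2 \<le> exp (t\<^sup>2)" by (rule exp_ge_add_one_self)
    ultimately show ?thesis by linarith
  qed
  show ?thesis using *[of y] *[of "- y"] assms by (cases "0 \<le> y") (auto simp: add.commute)
qed

lemma sum_exp_abs_rademacher_le:
  fixes y :: "nat \<Rightarrow> real"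
  assumes "\<And>i. i < k \<Longrightarrow> \<bar>y i\<bar> \<le> 1" "0 \<le> c" "c \<le> 1"
  shows "(\<Sum>A\<in>Pow {..<k}. exp (c * \<bar>\<Sum>i<k. rademacher A i * y i\<bar>)) \<le> 2 * 2 ^ k * exp (c\<^sup>2 * k)"
proof -
  have bound: "(\<Sum>A\<in>Pow {..<k}. exp (\<Sum>i<k. rademacher A i * (s * y i))) \<le> 2 ^ k * exp (c\<^sup>2 * k)"
    if "\<bar>s\<bar> = c" for s
  proof -
    have "(\<Prod>i<k. exp (s * y i) + exp (- (s * y i))) \<le> (\<Prod>i<k. 2 * exp (c\<^sup>2))"
    proof (rule prod_mono, safe)
      fix i assume "i < k"
      have sy: "\<bar>s * y i\<bar> \<le> c" using assms(1)[OF \<open>i < k\<close>] assms(2) that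
        by (simp add: abs_mult mult_left_le)
      then have "exp (s * y i) + exp (- (s * y i)) \<le> 2 * exp ((s * y i)\<^sup>2)"
        using assms(3) by (intro exp_add_exp_minus_le) auto
      also have "(s * y i)\<^sup>2 \<le> c\<^sup>2" using sy assms(2) abs_le_square_iff[of "s * y i" c] by simp
      finally show "exp (s * y i) + exp (- (s * y i)) \<le> 2 * exp (c\<^sup>2)" by simp
    qed (simp add: add_nonneg_nonneg)
    then show ?thesis
      by (simp add: sum_exp_rademacher power_mult_distrib flip: exp_of_nat_mult mult.commute[of "c\<^sup>2"])
  qed
  have "exp (c * \<bar>\<Sum>i<k. rademacher A i * y i\<bar>) \<le> exp (\<Sum>i<k. rademacher A i * (c * y i)) + exp (\<Sum>i<k. rademacher A i * (- c * y i))" for A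
  proof -
    have "(\<Sum>i<k. rademacher A i * (c * y i)) = c * (\<Sum>i<k. rademacher A i * y i)"
      "(\<Sum>i<k. rademacher A i * (- c * y i)) = - (c * (\<Sum>i<k. rademacher A i * y i))"
      by (simp_all add: sum_distrib_left mult.left_commute sum_negf)
    moreover have "exp (c * \<bar>t\<bar>) \<le> exp (c * t) + exp (- (c * t))" for t
      by (cases "0 \<le> t") auto
    ultimately show ?thesis by presburger
  qed
  then have "(\<Sum>A\<in>Pow {..<k}. exp (c * \<bar>\<Sum>i<k. rademacher A i * y i\<bar>))
      \<le> (\<Sum>A\<in>Pow {..<k}. exp (\<Sum>i<k. rademacher A i * (c * y i)) + exp (\<Sum>i<k. rademacher A i * (- c * y i)))"
    by (rule sum_mono)
  also have "\<dots> \<le> 2 ^ k * exp (c\<^sup>2 * k) + 2 ^ k * exp (c\<^sup>2 * k)"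
    unfolding sum.distrib using assms(2) by (intro add_mono bound) auto
  finally show ?thesis by simp
qed

text \<open>Massart's maximal inequality; the bound \<open>t \<le> b + exp (t - b)\<close> replaces Jensen's inequality.\<close>
lemma sum_max_rademacher_le:
  fixes y :: "'r \<Rightarrow> nat \<Rightarrow> real"
  assumes "finite R" and y: "\<And>r i. r \<in> R \<Longrightarrow> i < k \<Longrightarrow> \<bar>y r i\<bar> \<le> 1" and c: "0 < c" "c \<le> 1"
    and M: "\<And>A. A \<subseteq> {..<k} \<Longrightarrow> \<exists>r\<in>R. M A \<le> \<bar>\<Sum>i<k. rademacher A i * y r i\<bar>"
  shows "(\<Sum>A\<in>Pow {..<k}. M A) \<le> 2 ^ k * (2 * c * k + 2 * card R * exp (- (c\<^sup>2 * k)) / c)"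
proof -
  \<comment> \<open>Twice the exponent in \<open>sum_exp_abs_rademacher_le\<close>: after division
    by \<open>exp b\<close> the exponential moment still decays like
    \<open>exp (- (c\<^sup>2 * k))\<close>, which beats a polynomial \<open>card R\<close>.\<close>
  define b where "b = 2 * c\<^sup>2 * k"
  define S where "S r A = (\<Sum>i<k. rademacher A i * y r i)" for r A
  have "c * M A \<le> b + (\<Sum>r\<in>R. exp (c * \<bar>S r A\<bar> - b))" if A: "A \<in> Pow {..<k}" for A
  proof -
    obtain r where r: "r \<in> R" "M A \<le> \<bar>S r A\<bar>" using M[of A] A unfolding S_def by blast
    then have "c * M A \<le> c * \<bar>S r A\<bar>" using c by simp
    also have "\<dots> \<le> b + exp (c * \<bar>S r A\<bar> - b)"
      using exp_ge_add_one_self[of "c * \<bar>S r A\<bar> - b"] by linarith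
    also have "exp (c * \<bar>S r A\<bar> - b) \<le> (\<Sum>r\<in>R. exp (c * \<bar>S r A\<bar> - b))"
      using assms(1) r(1) by (intro member_le_sum) auto
    finally show ?thesis by simp
  qed
  then have "(\<Sum>A\<in>Pow {..<k}. c * M A) \<le> (\<Sum>A\<in>Pow {..<k}. b + (\<Sum>r\<in>R. exp (c * \<bar>S r A\<bar> - b)))"
    by (rule sum_mono)
  also have "\<dots> = 2 ^ k * b + (\<Sum>r\<in>R. (\<Sum>A\<in>Pow {..<k}. exp (c * \<bar>S r A\<bar>)) * exp (- b))"
    by (simp add: sum.distrib card_Pow sum.swap[of _ R] exp_diff exp_minus divide_inverse sum_distrib_right)
  also have "\<dots> \<le> 2 ^ k * b + (\<Sum>r\<in>R. (2 * 2 ^ k * exp (c\<^sup>2 * k)) * exp (- b))"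
    unfolding S_def using y c by (intro add_left_mono sum_mono mult_right_mono sum_exp_abs_rademacher_le) auto
  also have "\<dots> = 2 ^ k * b + card R * (2 * 2 ^ k * exp (- (c\<^sup>2 * k)))"
    by (simp add: b_def mult.assoc flip: exp_add)
  finally have "c * (\<Sum>A\<in>Pow {..<k}. M A) \<le> 2 ^ k * b + card R * (2 * 2 ^ k * exp (- (c\<^sup>2 * k)))"
    by (simp add: sum_distrib_left)
  then have "(\<Sum>A\<in>Pow {..<k}. M A) \<le> (2 ^ k * b + card R * (2 * 2 ^ k * exp (- (c\<^sup>2 * k)))) / c"
    using c by (simp add: pos_le_divide_eq mult.commute)
  also have "\<dots> = 2 ^ k * (2 * c * k + 2 * card R * exp (- (c\<^sup>2 * k)) / c)"
    using c by (simp add: b_def field_simps power2_eq_square)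
  finally show ?thesis .
qed

text \<open>\<open>K\<close> depends on the tolerance alone. This uniformity in \<open>f\<close> is
  what survives the passage to convex hulls.\<close>

definition rademacher_averages_vanish :: "'e::real_normed_vector set \<Rightarrow> bool" where
  "rademacher_averages_vanish F \<longleftrightarrow> (\<forall>\<eta>>0::real. \<exists>K. \<forall>k\<ge>K. \<forall>f. (\<forall>i<k. f i \<in> F) \<longrightarrow>
     (\<Sum>A\<in>Pow {..<k}. norm (\<Sum>i<k. rademacher A i *\<^sub>R f i)) \<le> \<eta> * real k * 2 ^ k)"

context finite_rank_compact_median_algebra
begin

text \<open>The sublevel sets at the multiples of \<open>1 / M\<close> locate each value up to
  \<open>1 / M\<close>, and they are only \<open>k * M\<close> halfspaces.\<close>

lemma halfspace_functions_net:
  assumes "0 < M" and f: "\<And>i. i < k \<Longrightarrow> halfspace_function (f i)"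
  shows "\<exists>R. finite R \<and> card R \<le> (k * M + 1) ^ n \<and>
    (\<forall>x. \<exists>r\<in>R. \<forall>i<k. \<bar>f i x - f i r\<bar> \<le> 1 / real M)"
proof -
  define H where "H = (\<lambda>(i, j). {x. f i x < real (Suc j) / real M})"
  have "halfspace (H p)" if "p \<in> {..<k} \<times> {..<M}" for p
    using that f unfolding H_def halfspace_function_def by auto
  then obtain R where R: "finite R" "card R \<le> (card ({..<k} \<times> {..<M}) + 1) ^ n"
    "\<And>x. \<exists>r\<in>R. \<forall>p\<in>{..<k} \<times> {..<M}. x \<in> H p \<longleftrightarrow> r \<in> H p"
    using halfspace_pattern_net[OF rank, of "{..<k} \<times> {..<M}" H] by auto
  have close: "f i x - f i r \<le> 1 / real M"
    if "i < k" and same: "\<And>j. j < M \<Longrightarrow> (i, j) \<in> {..<k} \<times> {..<M} \<Longrightarrow> x \<in> H (i, j) \<longleftrightarrow> r \<in> H (i, j)" for i x r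
  proof -
    have f01: "0 \<le> f i r" "f i r \<le> 1" "f i x \<le> 1"
      using f[OF that(1)] unfolding halfspace_function_def by (auto dest: range_subsetD)
    define j where "j = nat \<lfloor>f i r * M\<rfloor>"
    have j: "real j \<le> f i r * M" "f i r * M < real (Suc j)"
      using f01 assms(1) unfolding j_def by (simp_all add: le_nat_iff) linarith+
    show ?thesis
    proof (cases "j < M")
      case True
      have "r \<in> H (i, j)" using j assms(1) unfolding H_def by (simp add: field_simps)
      then have "x \<in> H (i, j)" using same[OF True] True that(1) by auto
      then have "f i x * M < real j + 1" using assms(1) unfolding H_def by (simp add: field_simps)
      then have "(f i x - f i r) * M \<le> 1" using j by (simp add: algebra_simps)
      then show ?thesis using assms(1) by (simp add: pos_le_divide_eq)
    next
      case False
      \<comment> \<open>Here \<open>f i r\<close> is the maximal value 1, and the upper bound holds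
        without any threshold.\<close>
      then have "real M \<le> f i r * M" using j by linarith
      then have "1 \<le> f i r" using assms(1) by simp
      then have "f i x - f i r \<le> 0" using f01 by linarith
      then show ?thesis by (rule order_trans) simp
    qed
  qed
  have "\<exists>r\<in>R. \<forall>i<k. \<bar>f i x - f i r\<bar> \<le> 1 / real M" for x
  proof -
    obtain r where "r \<in> R" "\<forall>p\<in>{..<k} \<times> {..<M}. x \<in> H p \<longleftrightarrow> r \<in> H p" using R(3) by blast
    then show ?thesis using close[of _ x r] close[of _ r x] by (intro bexI[of _ r]) (auto simp: abs_le_iff)
  qed
  then show ?thesis using R(1,2) by (auto simp: card_cartesian_product)
qed

definition atoms :: "('x \<Rightarrow>\<^sub>C real) set" where
  "atoms = {f. \<exists>h. halfspace_function (apply_bcontfun h) \<and> (f = h \<or> f = - h)}"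

lemma rademacher_averages_vanish_atoms: "rademacher_averages_vanish atoms"
  unfolding rademacher_averages_vanish_def
proof (intro allI impI)
  fix \<eta> :: real assume "\<eta> > 0"
  \<comment> \<open>The tolerance is shared equally by the error \<open>1 / M\<close> of the net,
    the linear term \<open>2 * c\<close> of the maximal inequality and its exponential
    remainder.\<close>
  obtain M0 :: nat where M0: "3 / \<eta> < real M0" using reals_Archimedean2 by blast
  define M where "M = Suc M0"
  have M: "0 < M" "1 / real M \<le> \<eta> / 3" using M0 \<open>\<eta> > 0\<close> by (simp_all add: M_def field_simps)
  define c where "c = min 1 (\<eta> / 6)"
  have c: "0 < c" "c \<le> 1" "2 * c \<le> \<eta> / 3" using \<open>\<eta> > 0\<close> by (auto simp: c_def)
  have "(\<lambda>k. 2 * (real k * real M + 1) ^ n * exp (- (c\<^sup>2 * real k)) / c) \<longlonglongrightarrow> 0"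
    using c(1) M(1) by real_asymp
  then have "\<forall>\<^sub>F k in sequentially. 2 * (real k * real M + 1) ^ n * exp (- (c\<^sup>2 * real k)) / c < \<eta> / 3"
    using \<open>\<eta> > 0\<close> by (intro order_tendstoD) auto
  then obtain K where K: "\<And>k. k \<ge> K \<Longrightarrow> 2 * (real k * real M + 1) ^ n * exp (- (c\<^sup>2 * real k)) / c < \<eta> / 3"
    by (auto simp: eventually_sequentially)
  show "\<exists>K. \<forall>k\<ge>K. \<forall>f. (\<forall>i<k. f i \<in> atoms) \<longrightarrow>
     (\<Sum>A\<in>Pow {..<k}. norm (\<Sum>i<k. rademacher A i *\<^sub>R f i)) \<le> \<eta> * k * 2 ^ k"
  \<comment> \<open>\<open>k \<ge> 1\<close> turns the constant bound on the remainder into a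
    multiple of \<open>k\<close>.\<close>
  proof (intro exI[of _ "max 1 K"] allI impI)
    fix k and f :: "nat \<Rightarrow> 'x \<Rightarrow>\<^sub>C real"
    assume k: "max 1 K \<le> k" and "\<forall>i<k. f i \<in> atoms"
    then have "\<forall>i. \<exists>h. i < k \<longrightarrow> halfspace_function (apply_bcontfun h) \<and> (f i = h \<or> f i = - h)"
      unfolding atoms_def by blast
    then obtain h where h: "\<And>i. i < k \<Longrightarrow> halfspace_function (apply_bcontfun (h i))"
      and fh: "\<And>i. i < k \<Longrightarrow> f i = h i \<or> f i = - h i"
      by metis
    obtain R where R: "finite R" "card R \<le> (k * M + 1) ^ n"
      "\<And>x. \<exists>r\<in>R. \<forall>i<k. \<bar>h i x - h i r\<bar> \<le> 1 / real M"
      using halfspace_functions_net[OF M(1), of k "\<lambda>i. apply_bcontfun (h i)"] h by auto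
    have f_diff: "\<bar>f i x - f i r\<bar> = \<bar>h i x - h i r\<bar>" if "i < k" for i x r
      using fh[OF that] by (auto simp: abs_minus_commute)
    have f_le: "\<bar>f i r\<bar> \<le> 1" if "i < k" for i r
      using fh[OF that] h[OF that] range_subsetD[of "apply_bcontfun (h i)" "{0..1}" r]
      by (auto simp: halfspace_function_def)
    have "R \<noteq> {}" using R(3) by blast
    define S where "S A x = (\<Sum>i<k. rademacher A i * f i x)" for A x
    have eval: "apply_bcontfun (\<Sum>i<k. rademacher A i *\<^sub>R f i) x = S A x" for A x
      unfolding S_def by (induction k) auto
    have "\<exists>r\<in>R. norm (\<Sum>i<k. rademacher A i *\<^sub>R f i) - k / real M \<le> \<bar>S A r\<bar>" for A
    proof -
      obtain r where r: "r \<in> R" "\<And>s. s \<in> R \<Longrightarrow> \<bar>S A s\<bar> \<le> \<bar>S A r\<bar>"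
        using Max_in[of "(\<lambda>s. \<bar>S A s\<bar>) ` R"] Max_ge[of "(\<lambda>s. \<bar>S A s\<bar>) ` R"] R(1) \<open>R \<noteq> {}\<close> by fastforce
      have "norm (\<Sum>i<k. rademacher A i *\<^sub>R f i) \<le> \<bar>S A r\<bar> + k / real M"
      proof (rule norm_bound)
        fix x
        obtain s where s: "s \<in> R" "\<And>i. i < k \<Longrightarrow> \<bar>f i x - f i s\<bar> \<le> 1 / real M"
          using R(3)[of x] f_diff by auto
        have "\<bar>S A x - S A s\<bar> = \<bar>\<Sum>i<k. rademacher A i * (f i x - f i s)\<bar>"
          by (simp add: S_def sum_subtractf right_diff_distrib)
        also have "\<dots> \<le> (\<Sum>i<k. \<bar>rademacher A i * (f i x - f i s)\<bar>)" by (rule sum_abs)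
        also have "\<dots> \<le> (\<Sum>i<k. 1 / real M)" using s(2) by (intro sum_mono) (simp add: abs_mult)
        finally have "\<bar>S A x - S A s\<bar> \<le> k / real M" by simp
        then show "norm (apply_bcontfun (\<Sum>i<k. rademacher A i *\<^sub>R f i) x) \<le> \<bar>S A r\<bar> + k / real M"
          unfolding eval using r(2)[OF s(1)] by simp
      qed
      then show ?thesis using r(1) by (intro bexI[of _ r]) simp
    qed
    then have avg: "(\<Sum>A\<in>Pow {..<k}. norm (\<Sum>i<k. rademacher A i *\<^sub>R f i) - k / real M)
        \<le> 2 ^ k * (2 * c * k + 2 * card R * exp (- (c\<^sup>2 * k)) / c)"
      using f_le c unfolding S_def
      by (intro sum_max_rademacher_le[OF R(1), where y = "\<lambda>r i. apply_bcontfun (f i) r"]) auto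
    have "2 * card R * exp (- (c\<^sup>2 * k)) / c \<le> \<eta> / 3 * k"
    proof -
      have "real (card R) \<le> (real k * real M + 1) ^ n"
        using R(2) by (metis of_nat_1 of_nat_add of_nat_le_iff of_nat_mult of_nat_power)
      then have "2 * card R * exp (- (c\<^sup>2 * k)) / c \<le> 2 * (real k * real M + 1) ^ n * exp (- (c\<^sup>2 * real k)) / c"
        using c(1) by (intro divide_right_mono mult_right_mono) auto
      also have "\<dots> \<le> \<eta> / 3" using K[of k] k by simp
      also have "\<dots> \<le> \<eta> / 3 * k" using k \<open>\<eta> > 0\<close> by simp
      finally show ?thesis .
    qed
    moreover have "2 * c * k \<le> \<eta> / 3 * k" using c(3) by (intro mult_right_mono) auto
    ultimately have "2 * c * k + 2 * card R * exp (- (c\<^sup>2 * k)) / c \<le> \<eta> / 3 * k + \<eta> / 3 * k"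
      by linarith
    then have "2 ^ k * (2 * c * k + 2 * card R * exp (- (c\<^sup>2 * k)) / c) \<le> 2 ^ k * (\<eta> / 3 * k + \<eta> / 3 * k)"
      by (rule mult_left_mono) simp
    moreover have "(\<Sum>A\<in>Pow {..<k}. norm (\<Sum>i<k. rademacher A i *\<^sub>R f i) - k / real M)
        = (\<Sum>A\<in>Pow {..<k}. norm (\<Sum>i<k. rademacher A i *\<^sub>R f i)) - 2 ^ k * (k / real M)"
      by (simp add: sum_subtractf card_Pow)
    ultimately have "(\<Sum>A\<in>Pow {..<k}. norm (\<Sum>i<k. rademacher A i *\<^sub>R f i)) - 2 ^ k * (k / real M)
        \<le> 2 ^ k * (\<eta> / 3 * k + \<eta> / 3 * k)"
      using avg by linarith
    moreover have "2 ^ k * (k / real M) \<le> 2 ^ k * (\<eta> / 3 * k)"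
      using mult_right_mono[OF M(2), of k] by (intro mult_left_mono) auto
    ultimately show "(\<Sum>A\<in>Pow {..<k}. norm (\<Sum>i<k. rademacher A i *\<^sub>R f i)) \<le> \<eta> * k * 2 ^ k"
      by (simp add: algebra_simps)
  qed
qed

end


section \<open>Interpolation\<close>

lemma sum_lessThan_add: "(\<Sum>i<s + k. f i) = (\<Sum>i<s. f i) + (\<Sum>i<k. f (s + i))"
  for f :: "nat \<Rightarrow> 'a::comm_monoid_add"
  by (induction k) (auto simp: add.assoc)

locale interpolation =
  fixes F :: "'e::real_normed_vector set"
  assumes complete: "\<And>\<sigma> :: nat \<Rightarrow> 'e. Cauchy \<sigma> \<Longrightarrow> convergent \<sigma>"
    and vanish: "rademacher_averages_vanish F"
    and norm_le_1: "\<And>f. f \<in> F \<Longrightarrow> norm f \<le> 1"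
    and uminus_F: "\<And>f. f \<in> F \<Longrightarrow> - f \<in> F"
    and zero_F: "0 \<in> F"
begin

definition W :: "'e set" where
  "W = convex hull F"

lemma convex_W: "convex W" and F_subset_W: "F \<subseteq> W" and zero_W: "0 \<in> W"
  unfolding W_def using zero_F by (auto intro: hull_inc)

lemma uminus_W: "w \<in> W \<Longrightarrow> - w \<in> W"
proof -
  have "convex (uminus -` W)"
    using convex_W convex_linear_vimage[of uminus W] by (auto simp: linear_uminus)
  then have "W \<subseteq> uminus -` W"
    unfolding W_def using uminus_F by (intro hull_minimal) (auto intro: hull_inc)
  then show "w \<in> W \<Longrightarrow> - w \<in> W" by auto
qed

lemma norm_W: "w \<in> W \<Longrightarrow> norm w \<le> 1"
proof -
  have "W \<subseteq> cball 0 1" unfolding W_def using norm_le_1 by (intro hull_minimal) auto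
  then show "w \<in> W \<Longrightarrow> norm w \<le> 1" by auto
qed

lemma scale_W: "w \<in> W \<Longrightarrow> 0 \<le> t \<Longrightarrow> t \<le> 1 \<Longrightarrow> t *\<^sub>R w \<in> W"
  using convexD[OF convex_W, of w 0 t "1 - t"] zero_W by simp

text \<open>The averaged norm is convex in each argument separately, so its maximum over \<open>W\<close> is attained
  at the extreme points.\<close>
lemma rademacher_averages_W:
  assumes F: "\<And>f. \<forall>i<k. f i \<in> F \<Longrightarrow> (\<Sum>A\<in>Pow {..<k}. norm (\<Sum>i<k. rademacher A i *\<^sub>R f i)) \<le> b"
    and w: "\<forall>i<k. w i \<in> W"
  shows "(\<Sum>A\<in>Pow {..<k}. norm (\<Sum>i<k. rademacher A i *\<^sub>R w i)) \<le> b"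
proof -
  define \<Phi> where "\<Phi> w = (\<Sum>A\<in>Pow {..<k}. norm (\<Sum>i<k. rademacher A i *\<^sub>R w i))" for w :: "nat \<Rightarrow> 'e"
  \<comment> \<open>The entries are released one at a time: the first \<open>j\<close> range over
    \<open>W\<close>, the others still over \<open>F\<close>.\<close>
  have main: "\<Phi> w \<le> b" if "j \<le> k" "\<forall>i<j. w i \<in> W" "\<forall>i. j \<le> i \<and> i < k \<longrightarrow> w i \<in> F" for w j
    using that
  proof (induction j arbitrary: w)
    case 0
    then show ?case using F by (simp add: \<Phi>_def)
  next
    case (Suc j)
    define rest where "rest A = (\<Sum>i\<in>{..<k} - {j}. rademacher A i *\<^sub>R w i)" for A
    have \<Phi>_upd: "\<Phi> (w(j := u)) = (\<Sum>A\<in>Pow {..<k}. norm (rademacher A j *\<^sub>R u + rest A))" for u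
      unfolding \<Phi>_def rest_def using Suc.prems(1)
      by (intro sum.cong refl arg_cong[of _ _ norm]) (simp add: sum.remove[of "{..<k}" j])
    have "convex {u. \<Phi> (w(j := u)) \<le> b}"
    proof (rule convexI)
      fix u v and s t :: real
      assume *: "u \<in> {u. \<Phi> (w(j := u)) \<le> b}" "v \<in> {u. \<Phi> (w(j := u)) \<le> b}" "0 \<le> s" "0 \<le> t" "s + t = 1"
      have "norm (rademacher A j *\<^sub>R (s *\<^sub>R u + t *\<^sub>R v) + rest A)
          \<le> s * norm (rademacher A j *\<^sub>R u + rest A) + t * norm (rademacher A j *\<^sub>R v + rest A)" for A
      proof -
        have "rest A = s *\<^sub>R rest A + t *\<^sub>R rest A" using *(5) by (simp flip: scaleR_left_distrib)
        then have "rademacher A j *\<^sub>R (s *\<^sub>R u + t *\<^sub>R v) + rest A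
            = s *\<^sub>R (rademacher A j *\<^sub>R u + rest A) + t *\<^sub>R (rademacher A j *\<^sub>R v + rest A)"
          by (simp add: algebra_simps)
        then show ?thesis using norm_triangle_ineq * by (metis abs_of_nonneg norm_scaleR)
      qed
      then have "\<Phi> (w(j := s *\<^sub>R u + t *\<^sub>R v)) \<le> s * \<Phi> (w(j := u)) + t * \<Phi> (w(j := v))"
        unfolding \<Phi>_upd sum_distrib_left sum.distrib[symmetric] by (rule sum_mono)
      also have "\<dots> \<le> b" using * by (auto intro: convex_bound_le)
      finally show "s *\<^sub>R u + t *\<^sub>R v \<in> {u. \<Phi> (w(j := u)) \<le> b}" by simp
    qed
    moreover have "F \<subseteq> {u. \<Phi> (w(j := u)) \<le> b}" using Suc.IH Suc.prems by auto
    ultimately have "W \<subseteq> {u. \<Phi> (w(j := u)) \<le> b}" unfolding W_def by (intro hull_minimal)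
    then have "\<Phi> (w(j := w j)) \<le> b" using Suc.prems by blast
    then show ?case by simp
  qed
  have "\<Phi> w \<le> b" by (rule main[of k]) (use w in auto)
  then show ?thesis by (simp add: \<Phi>_def)
qed

text \<open>Up to a factor of two, \<open>K n\<close> is the gauge of \<open>2\<^sup>n W + 2\<^sup>-\<^sup>n B\<close> in the Davis--Figiel--Johnson--Pelczynski
  construction, where \<open>B\<close> is the unit ball. The \<open>c\<^sub>0\<close>-sum of these gauges suffices here, since
  reflexivity is not an issue.\<close>

definition K :: "nat \<Rightarrow> 'e \<Rightarrow> real" where
  "K n f = Inf {c / 2 ^ n + 2 ^ n * norm (f - c *\<^sub>R w) | c w. 0 \<le> c \<and> w \<in> W}"

lemma K_bdd: "bdd_below {c / 2 ^ n + 2 ^ n * norm (f - c *\<^sub>R w) | c w. 0 \<le> c \<and> w \<in> W}"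
  by (rule bdd_belowI[of _ 0]) auto

lemma K_le: "0 \<le> c \<Longrightarrow> w \<in> W \<Longrightarrow> K n f \<le> c / 2 ^ n + 2 ^ n * norm (f - c *\<^sub>R w)"
  unfolding K_def by (intro cInf_lower K_bdd) auto

lemma K_lessE:
  assumes "K n f < e"
  obtains c w where "0 \<le> c" "w \<in> W" "c / 2 ^ n + 2 ^ n * norm (f - c *\<^sub>R w) < e"
proof -
  have "{c / 2 ^ n + 2 ^ n * norm (f - c *\<^sub>R w) | c w. 0 \<le> c \<and> w \<in> W} \<noteq> {}" using zero_W by blast
  from cInf_lessD[OF this assms[unfolded K_def]] show ?thesis using that by blast
qed

lemma K_nonneg: "0 \<le> K n f"
proof (rule ccontr)
  assume "\<not> 0 \<le> K n f"
  then obtain c w where "0 \<le> c" "c / 2 ^ n + 2 ^ n * norm (f - c *\<^sub>R w) < 0"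
    using K_lessE by (metis not_le)
  moreover have "0 \<le> c / 2 ^ n" "0 \<le> 2 ^ n * norm (f - c *\<^sub>R w)" using \<open>0 \<le> c\<close> by auto
  ultimately show False by linarith
qed

lemma K_le_norm: "K n f \<le> 2 ^ n * norm f"
  using K_le[of 0 0 n f] zero_W by simp

text \<open>With \<open>K_le_norm\<close>, every \<open>K n\<close> is equivalent to the norm, with
  constants that get worse as \<open>n\<close> grows. The proof uses that \<open>W\<close> lies in
  the unit ball.\<close>

lemma norm_le_K: "norm f \<le> 2 ^ n * K n f"
proof (rule field_le_epsilon)
  fix e :: real assume "e > 0"
  then have "K n f < K n f + e / 2 ^ n" by simp
  then obtain c w where cw: "0 \<le> c" "w \<in> W" "c / 2 ^ n + 2 ^ n * norm (f - c *\<^sub>R w) < K n f + e / 2 ^ n"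
    by (rule K_lessE)
  have "norm f \<le> norm (c *\<^sub>R w) + norm (f - c *\<^sub>R w)" by (metis add_diff_cancel_left' norm_triangle_sub)
  also have "norm (c *\<^sub>R w) \<le> c" using norm_W[OF cw(2)] cw(1) by (simp add: mult_left_le)
  also have "norm (f - c *\<^sub>R w) \<le> (2 ^ n * 2 ^ n) * norm (f - c *\<^sub>R w)"
    using mult_right_mono[of 1 "2 ^ n * 2 ^ n :: real" "norm (f - c *\<^sub>R w)"]
    by (simp flip: power_mult_distrib)
  also have "c + (2 ^ n * 2 ^ n) * norm (f - c *\<^sub>R w) = 2 ^ n * (c / 2 ^ n + 2 ^ n * norm (f - c *\<^sub>R w))"
    by (simp add: field_simps)
  also have "\<dots> \<le> 2 ^ n * (K n f + e / 2 ^ n)" using cw(3) by (intro mult_left_mono) auto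
  finally show "norm f \<le> 2 ^ n * K n f + e" by (simp add: algebra_simps)
qed

lemma K_add: "K n (f + g) \<le> K n f + K n g"
proof (rule field_le_epsilon)
  fix e :: real assume "e > 0"
  then have "K n f < K n f + e / 2" "K n g < K n g + e / 2" by auto
  then obtain c w d v where cw: "0 \<le> c" "w \<in> W" "c / 2 ^ n + 2 ^ n * norm (f - c *\<^sub>R w) < K n f + e / 2"
    and dv: "0 \<le> d" "v \<in> W" "d / 2 ^ n + 2 ^ n * norm (g - d *\<^sub>R v) < K n g + e / 2"
    by (elim K_lessE)
  obtain u where u: "u \<in> W" "(c + d) *\<^sub>R u = c *\<^sub>R w + d *\<^sub>R v"
  proof (cases "c + d = 0")
    case True
    then have "c = 0" "d = 0" using cw dv by auto
    then show ?thesis using that[OF zero_W] by simp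
  next
    case False
    then have "(c / (c + d)) *\<^sub>R w + (d / (c + d)) *\<^sub>R v \<in> W"
      using cw(1,2) dv(1,2)
      by (intro convexD[OF convex_W]) (auto simp: add_divide_distrib[symmetric])
    then show ?thesis using that False by (simp add: scaleR_right_distrib)
  qed
  have "K n (f + g) \<le> (c + d) / 2 ^ n + 2 ^ n * norm (f + g - (c + d) *\<^sub>R u)"
    using cw dv u by (intro K_le) auto
  also have "norm (f + g - (c + d) *\<^sub>R u) \<le> norm (f - c *\<^sub>R w) + norm (g - d *\<^sub>R v)"
    unfolding u(2) using norm_triangle_ineq[of "f - c *\<^sub>R w" "g - d *\<^sub>R v"] by (simp add: algebra_simps)
  finally show "K n (f + g) \<le> K n f + K n g + e"
    using cw(3) dv(3) by (simp add: add_divide_distrib distrib_left)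
qed

text \<open>The factor \<open>r\<close> allows one proof for scalars, where it is the absolute
  value, and for isometries preserving \<open>F\<close>, where it is 1.\<close>

lemma K_image_le:
  assumes U: "\<And>u v. U (u - v) = U u - U v" "\<And>a v. U (a *\<^sub>R v) = a *\<^sub>R U v"
    and norm: "\<And>v. norm (U v) = r * norm v" "0 \<le> r" and W: "\<And>w. w \<in> W \<Longrightarrow> \<exists>w'\<in>W. U w = r *\<^sub>R w'"
  shows "K n (U f) \<le> r * K n f"
proof (rule field_le_epsilon)
  fix e :: real assume "e > 0"
  \<comment> \<open>The shift by 1 covers \<open>r = 0\<close>.\<close>
  define e' where "e' = e / (r + 1)"
  have e': "e' > 0" "r * e' \<le> e" using \<open>e > 0\<close> norm(2) by (auto simp: e'_def field_simps)
  then have "K n f < K n f + e'" by simp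
  then obtain c w where cw: "0 \<le> c" "w \<in> W" "c / 2 ^ n + 2 ^ n * norm (f - c *\<^sub>R w) < K n f + e'"
    by (rule K_lessE)
  obtain w' where w': "w' \<in> W" "U w = r *\<^sub>R w'" using W cw(2) by blast
  have "K n (U f) \<le> (r * c) / 2 ^ n + 2 ^ n * norm (U f - (r * c) *\<^sub>R w')"
    using cw norm(2) w' by (intro K_le) auto
  also have "U f - (r * c) *\<^sub>R w' = U (f - c *\<^sub>R w)"
    using w'(2) by (simp add: U mult.commute)
  also have "(r * c) / 2 ^ n + 2 ^ n * norm (U (f - c *\<^sub>R w)) = r * (c / 2 ^ n + 2 ^ n * norm (f - c *\<^sub>R w))"
    by (simp add: norm algebra_simps)
  also have "\<dots> \<le> r * (K n f + e')" using cw(3) norm(2) by (intro mult_left_mono) auto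
  finally show "K n (U f) \<le> r * K n f + e" using e'(2) by (simp add: algebra_simps)
qed

lemma K_scaleR: "K n (a *\<^sub>R f) = \<bar>a\<bar> * K n f"
proof -
  have le: "K n (a *\<^sub>R f) \<le> \<bar>a\<bar> * K n f" for a f
  proof (rule K_image_le)
    show "\<exists>w'\<in>W. a *\<^sub>R w = \<bar>a\<bar> *\<^sub>R w'" if "w \<in> W" for w
      using that uminus_W[OF that] by (cases "0 \<le> a") (auto intro: bexI[of _ w] bexI[of _ "- w"])
  qed (auto simp: algebra_simps)
  show ?thesis
  proof (cases "a = 0")
    case True
    then show ?thesis using le[of 0 f] K_nonneg[of n 0] by simp
  next
    case False
    then have "K n f \<le> K n (a *\<^sub>R f) / \<bar>a\<bar>"
      using le[of "inverse a" "a *\<^sub>R f"] by (simp add: abs_inverse divide_inverse mult.commute)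
    then have "\<bar>a\<bar> * K n f \<le> K n (a *\<^sub>R f)" using False by (simp add: field_simps)
    then show ?thesis using le[of a f] by simp
  qed
qed

lemma K_zero [simp]: "K n 0 = 0"
  using K_scaleR[of n 0 0] by simp

lemma K_uminus [simp]: "K n (- f) = K n f"
  using K_scaleR[of n "-1" f] by simp

lemma K_diff: "K n (f - g) \<le> K n f + K n g"
  using K_add[of n f "- g"] by simp

lemma K_F: "f \<in> F \<Longrightarrow> K n f \<le> (1 / 2) ^ n"
  using K_le[of 1 f n f] F_subset_W by (auto simp: power_one_over)

lemma K_sum_le: "K n (\<Sum>i\<in>I. f i) \<le> (\<Sum>i\<in>I. K n (f i))"
proof (induction I rule: infinite_finite_induct)
  case (insert i I)
  then show ?case using K_add[of n "f i" "\<Sum>i\<in>I. f i"] by simp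
qed auto

text \<open>Null sequences rather than bounded ones: the decay of \<open>K n f\<close> drives both
  the gliding hump against \<open>ell1\<close> and the strong continuity of the group
  action.\<close>

definition V :: "'e set" where
  "V = {f. (\<lambda>n. K n f) \<longlonglongrightarrow> 0}"

definition N :: "'e \<Rightarrow> real" where
  "N f = (SUP n. K n f)"

lemma N_uminus [simp]: "N (- f) = N f"
  by (simp add: N_def)

lemma F_subset_V: "F \<subseteq> V"
proof
  fix f assume "f \<in> F"
  show "f \<in> V" unfolding V_def
  proof (rule CollectI, rule tendsto_sandwich[of "\<lambda>_. 0" _ _ "\<lambda>n. (1 / 2) ^ n"])
    show "(\<lambda>n. (1 / 2 :: real) ^ n) \<longlonglongrightarrow> 0" by (simp add: LIMSEQ_power_zero)
  qed (use K_F[OF \<open>f \<in> F\<close>] K_nonneg in auto)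
qed

lemma subspace_V: "subspace V"
proof (rule subspaceI)
  show "0 \<in> V" by (simp add: V_def)
  show "f + g \<in> V" if "f \<in> V" "g \<in> V" for f g
  proof -
    have "(\<lambda>n. K n f + K n g) \<longlonglongrightarrow> 0" using that tendsto_add[of "\<lambda>n. K n f" 0] by (auto simp: V_def)
    then show ?thesis unfolding V_def mem_Collect_eq
      by (rule tendsto_sandwich[rotated 3]) (auto simp: K_add K_nonneg)
  qed
  show "a *\<^sub>R f \<in> V" if "f \<in> V" for a f
    using that tendsto_mult_right_zero[of "\<lambda>n. K n f" _ "\<bar>a\<bar>"] by (simp add: V_def K_scaleR)
qed

lemma K_le_N:
  assumes "f \<in> V"
  shows "K n f \<le> N f"
  unfolding N_def
proof (rule cSUP_upper)
  have "Bseq (\<lambda>n. K n f)" using assms unfolding V_def by (auto intro: convergent_imp_Bseq convergentI)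
  then show "bdd_above (range (\<lambda>n. K n f))" by (rule Bseq_bdd_above)
qed simp

lemma N_le: "(\<And>n. K n f \<le> b) \<Longrightarrow> N f \<le> b"
  unfolding N_def by (rule cSUP_least) auto

lemma norm_le_N: "f \<in> V \<Longrightarrow> norm f \<le> N f"
  using norm_le_K[of f 0] K_le_N[of f 0] by simp

lemma norm_on_V: "norm_on V N"
  unfolding norm_on_def
proof (intro conjI ballI allI)
  fix f assume f: "f \<in> V"
  show "0 \<le> N f" using norm_le_N[OF f] norm_ge_zero[of f] by linarith
  show "N f = 0 \<longleftrightarrow> f = 0"
  proof
    show "N f = 0 \<Longrightarrow> f = 0" using norm_le_N[OF f] by simp
    show "f = 0 \<Longrightarrow> N f = 0" by (simp add: N_def)
  qed
  fix a :: real
  show "N (a *\<^sub>R f) = \<bar>a\<bar> * N f"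
  proof (rule antisym)
    show "N (a *\<^sub>R f) \<le> \<bar>a\<bar> * N f"
      using K_le_N[OF f] by (intro N_le) (auto simp: K_scaleR intro: mult_left_mono)
    show "\<bar>a\<bar> * N f \<le> N (a *\<^sub>R f)"
    proof (cases "a = 0")
      case False
      have "N f \<le> N (a *\<^sub>R f) / \<bar>a\<bar>"
      proof (rule N_le)
        fix n
        have "\<bar>a\<bar> * K n f \<le> N (a *\<^sub>R f)"
          using K_le_N[OF subspace_scale[OF subspace_V f], of n a] by (simp add: K_scaleR)
        then show "K n f \<le> N (a *\<^sub>R f) / \<bar>a\<bar>" using False by (simp add: field_simps)
      qed
      then show ?thesis using False by (simp add: field_simps)
    qed (simp add: N_def)
  qed
next
  fix f g assume "f \<in> V" "g \<in> V"
  then show "N (f + g) \<le> N f + N g"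
    by (intro N_le order_trans[OF K_add] add_mono K_le_N)
qed

sublocale V: Metric_space V "norm_dist V N"
  by (rule Metric_space_norm_dist[OF subspace_V norm_on_V])

text \<open>A Cauchy sequence for \<open>N\<close> has a limit in the original norm. Each
  \<open>K n\<close> is continuous for that norm, so the Cauchy estimates pass to the limit
  uniformly in \<open>n\<close>, and a uniform limit of null sequences is null.\<close>

lemma mcomplete_V: "Metric_space.mcomplete V (norm_dist V N)"
  unfolding V.mcomplete_def
proof (intro allI impI)
  fix \<sigma> assume "V.MCauchy \<sigma>"
  then have \<sigma>V: "\<sigma> i \<in> V" and
    cauchy: "\<And>e. e > 0 \<Longrightarrow> \<exists>M. \<forall>i j. M \<le> i \<longrightarrow> M \<le> j \<longrightarrow> norm_dist V N (\<sigma> i) (\<sigma> j) < e" for i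
    unfolding V.MCauchy_def by auto
  have diff: "\<sigma> i - \<sigma> j \<in> V" for i j using \<sigma>V subspace_diff[OF subspace_V] by blast
  have K_cauchy: "\<exists>M. \<forall>i\<ge>M. \<forall>j\<ge>M. \<forall>n. K n (\<sigma> i - \<sigma> j) \<le> e" if e: "e > 0" for e
  proof -
    obtain M where M: "\<forall>i j. M \<le> i \<longrightarrow> M \<le> j \<longrightarrow> norm_dist V N (\<sigma> i) (\<sigma> j) < e"
      using cauchy[OF e] by blast
    have "K n (\<sigma> i - \<sigma> j) \<le> e" if "i \<ge> M" "j \<ge> M" for i j n
      using K_le_N[OF diff[of i j], of n] M that \<sigma>V by (fastforce simp: norm_dist_def)
    then show ?thesis by blast
  qed
  have "Cauchy \<sigma>"
  proof (rule metric_CauchyI)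
    fix e :: real assume "e > 0"
    then obtain M where M: "\<forall>i\<ge>M. \<forall>j\<ge>M. \<forall>n. K n (\<sigma> i - \<sigma> j) \<le> e / 2"
      using K_cauchy[of "e / 2"] by auto
    have "dist (\<sigma> i) (\<sigma> j) < e" if "i \<ge> M" "j \<ge> M" for i j
    proof -
      have "K 0 (\<sigma> i - \<sigma> j) \<le> e / 2" using M that by blast
      then show ?thesis using norm_le_K[of "\<sigma> i - \<sigma> j" 0] \<open>e > 0\<close> by (simp add: dist_norm)
    qed
    then show "\<exists>M. \<forall>i\<ge>M. \<forall>j\<ge>M. dist (\<sigma> i) (\<sigma> j) < e" by blast
  qed
  then obtain f where f: "\<sigma> \<longlonglongrightarrow> f" using complete convergent_def by blast
  have K_lim: "\<exists>M. \<forall>i\<ge>M. \<forall>n. K n (\<sigma> i - f) \<le> e" if e: "e > 0" for e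
  proof -
    obtain M where M: "\<forall>i\<ge>M. \<forall>j\<ge>M. \<forall>n. K n (\<sigma> i - \<sigma> j) \<le> e" using K_cauchy[OF e] by blast
    have "K n (\<sigma> i - f) \<le> e" if "i \<ge> M" for i n
    proof (rule tendsto_lowerbound)
      have "(\<lambda>j. e + 2 ^ n * norm (\<sigma> j - f)) \<longlonglongrightarrow> e + 2 ^ n * norm (f - f)"
        using f by (intro tendsto_intros)
      then show "(\<lambda>j. e + 2 ^ n * norm (\<sigma> j - f)) \<longlonglongrightarrow> e" by simp
      show "\<forall>\<^sub>F j in sequentially. K n (\<sigma> i - f) \<le> e + 2 ^ n * norm (\<sigma> j - f)"
        unfolding eventually_sequentially
      proof (intro exI[of _ M] allI impI)
        fix j assume "M \<le> j"
        have "K n (\<sigma> i - f) \<le> K n (\<sigma> i - \<sigma> j) + K n (\<sigma> j - f)"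
          using K_add[of n "\<sigma> i - \<sigma> j" "\<sigma> j - f"] by simp
        also have "\<dots> \<le> e + 2 ^ n * norm (\<sigma> j - f)"
          using M that \<open>M \<le> j\<close> by (intro add_mono K_le_norm) auto
        finally show "K n (\<sigma> i - f) \<le> e + 2 ^ n * norm (\<sigma> j - f)" .
      qed
    qed simp
    then show ?thesis by blast
  qed
  have "f \<in> V"
    unfolding V_def
  proof (rule CollectI, rule LIMSEQ_I)
    fix e :: real assume "e > 0"
    then obtain i where i: "\<forall>n. K n (\<sigma> i - f) \<le> e / 2" using K_lim[of "e / 2"] by auto
    have "(\<lambda>n. K n (\<sigma> i)) \<longlonglongrightarrow> 0" using \<sigma>V[of i] by (simp add: V_def)
    then obtain M where M: "\<forall>n\<ge>M. norm (K n (\<sigma> i) - 0) < e / 2"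
      using LIMSEQ_D[of "\<lambda>n. K n (\<sigma> i)" 0 "e / 2"] \<open>e > 0\<close> by auto
    have "norm (K n f - 0) < e" if "n \<ge> M" for n
    proof -
      have "K n f \<le> K n (\<sigma> i) + K n (\<sigma> i - f)" using K_diff[of n "\<sigma> i" "\<sigma> i - f"] by simp
      then show ?thesis using i M that K_nonneg[of n f] K_nonneg[of n "\<sigma> i"] by (smt (verit) field_sum_of_halves real_norm_def)
    qed
    then show "\<exists>M. \<forall>n\<ge>M. norm (K n f - 0) < e" by blast
  qed
  moreover have "\<forall>\<^sub>F i in sequentially. \<sigma> i \<in> V \<and> norm_dist V N (\<sigma> i) f < e" if e: "e > 0" for e
  proof -
    obtain M where M: "\<forall>i\<ge>M. \<forall>n. K n (\<sigma> i - f) \<le> e / 2" using K_lim[of "e / 2"] e by auto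
    have "norm_dist V N (\<sigma> i) f < e" if "i \<ge> M" for i
      using N_le[of "\<sigma> i - f" "e / 2"] M that e \<open>f \<in> V\<close> \<sigma>V by (fastforce simp: norm_dist_def)
    then show ?thesis using \<sigma>V by (auto simp: eventually_sequentially)
  qed
  ultimately show "\<exists>x. limitin V.mtopology \<sigma> x sequentially"
    by (auto simp: V.limitin_metric)
qed

lemma banach_V: "banach_space_on V N"
  using subspace_V norm_on_V mcomplete_V by (simp add: banach_space_on_def)

text \<open>A single level \<open>l\<close> of the norm \<open>N\<close> places all
  \<open>v i\<close> near one multiple of \<open>W\<close>, where averages are small. This gives
  smallness in the original norm, which controls the finitely many levels up to
  \<open>M\<close>.\<close>

lemma small_rademacher_average:
  assumes v: "\<And>i. v i \<in> V" "\<And>i. N (v i) \<le> C" and "0 < \<eta>"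
  shows "\<exists>k A. 0 < k \<and> (\<forall>n\<le>M. K n ((1 / real k) *\<^sub>R (\<Sum>i<k. rademacher A i *\<^sub>R v i)) \<le> \<eta>)"
proof -
  \<comment> \<open>\<open>K n\<close> is at most \<open>2 ^ M\<close> times the norm for
    \<open>n \<le> M\<close>. Half of this allowance goes to the distance from
    \<open>D *\<^sub>R w i\<close>, half to the average of the \<open>w i\<close>.\<close>
  define \<delta> where "\<delta> = \<eta> / 2 ^ M"
  define C' where "C' = \<bar>C\<bar> + 1"
  have "0 < \<delta>" "0 < C'" using assms by (auto simp: \<delta>_def C'_def)
  obtain l where l: "2 * C' / \<delta> < 2 ^ l" using real_arch_pow[of 2] by auto
  then have l': "C' / 2 ^ l \<le> \<delta> / 2" using \<open>0 < \<delta>\<close> by (simp add: field_simps)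
  \<comment> \<open>A common bound for the coefficients \<open>c\<close> of the near-optimal
    decompositions at level \<open>l\<close>.\<close>
  define D where "D = 2 ^ l * C'"
  have "0 < D" using \<open>0 < C'\<close> by (simp add: D_def)
  obtain k0 where k0: "\<And>k f. k \<ge> k0 \<Longrightarrow> \<forall>i<k. f i \<in> F \<Longrightarrow>
     (\<Sum>A\<in>Pow {..<k}. norm (\<Sum>i<k. rademacher A i *\<^sub>R f i)) \<le> \<delta> / (2 * D) * real k * 2 ^ k"
    using vanish[unfolded rademacher_averages_vanish_def, rule_format, of "\<delta> / (2 * D)"]
      \<open>0 < \<delta>\<close> \<open>0 < D\<close> by auto
  define k where "k = max 1 k0"
  have "0 < k" "k0 \<le> k" by (simp_all add: k_def)
  have "\<exists>w\<in>W. norm (v i - D *\<^sub>R w) \<le> C' / 2 ^ l" for i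
  proof -
    have "K l (v i) < C'" using K_le_N[OF v(1), of l i] v(2)[of i] by (simp add: C'_def)
    then obtain c w where cw: "0 \<le> c" "w \<in> W" "c / 2 ^ l + 2 ^ l * norm (v i - c *\<^sub>R w) < C'"
      by (rule K_lessE)
    have "0 \<le> c / 2 ^ l" "0 \<le> 2 ^ l * norm (v i - c *\<^sub>R w)" using cw(1) by auto
    then have "c / 2 ^ l \<le> C'" and *: "2 ^ l * norm (v i - c *\<^sub>R w) \<le> C'" using cw(3) by linarith+
    then have "c / D \<le> 1" using \<open>0 < C'\<close> by (simp add: D_def field_simps)
    then have "(c / D) *\<^sub>R w \<in> W" using cw \<open>0 < D\<close> by (intro scale_W) auto
    moreover have "norm (v i - D *\<^sub>R ((c / D) *\<^sub>R w)) \<le> C' / 2 ^ l"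
      using * \<open>0 < D\<close> by (simp add: field_simps)
    ultimately show ?thesis by blast
  qed
  then obtain w where w: "\<And>i. w i \<in> W" "\<And>i. norm (v i - D *\<^sub>R w i) \<le> C' / 2 ^ l" by metis
  have W_avg: "(\<Sum>A\<in>Pow {..<k}. norm (\<Sum>i<k. rademacher A i *\<^sub>R w i)) \<le> \<delta> / (2 * D) * real k * 2 ^ k"
    by (rule rademacher_averages_W[OF k0[OF \<open>k0 \<le> k\<close>]]) (use w(1) in auto)
  have "norm (\<Sum>i<k. rademacher A i *\<^sub>R v i) \<le> D * norm (\<Sum>i<k. rademacher A i *\<^sub>R w i) + k * (\<delta> / 2)" for A
  proof -
    have "(\<Sum>i<k. rademacher A i *\<^sub>R v i)
        = D *\<^sub>R (\<Sum>i<k. rademacher A i *\<^sub>R w i) + (\<Sum>i<k. rademacher A i *\<^sub>R (v i - D *\<^sub>R w i))"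
      by (simp add: scaleR_sum_right sum.distrib[symmetric] algebra_simps)
    moreover have "norm (\<Sum>i<k. rademacher A i *\<^sub>R (v i - D *\<^sub>R w i)) \<le> (\<Sum>i<k. \<delta> / 2)"
      using order_trans[OF w(2) l'] by (intro sum_norm_le) simp
    ultimately show ?thesis
      using norm_triangle_ineq[of "D *\<^sub>R (\<Sum>i<k. rademacher A i *\<^sub>R w i)"
          "\<Sum>i<k. rademacher A i *\<^sub>R (v i - D *\<^sub>R w i)"] \<open>0 < D\<close>
      by (simp del: sum.lessThan_Suc)
  qed
  then have "(\<Sum>A\<in>Pow {..<k}. norm (\<Sum>i<k. rademacher A i *\<^sub>R v i))
      \<le> (\<Sum>A\<in>Pow {..<k}. D * norm (\<Sum>i<k. rademacher A i *\<^sub>R w i) + k * (\<delta> / 2))"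
    by (rule sum_mono)
  also have "\<dots> = D * (\<Sum>A\<in>Pow {..<k}. norm (\<Sum>i<k. rademacher A i *\<^sub>R w i)) + 2 ^ k * (k * (\<delta> / 2))"
    by (simp add: sum.distrib sum_distrib_left card_Pow)
  also have "\<dots> \<le> D * (\<delta> / (2 * D) * real k * 2 ^ k) + 2 ^ k * (k * (\<delta> / 2))"
    using \<open>0 < D\<close> W_avg by (intro add_right_mono mult_left_mono) auto
  also have "\<dots> = (\<Sum>A\<in>Pow {..<k}. k * \<delta>)"
    using \<open>0 < D\<close> by (simp add: card_Pow)
  finally have avg: "(\<Sum>A\<in>Pow {..<k}. norm (\<Sum>i<k. rademacher A i *\<^sub>R v i)) \<le> (\<Sum>A\<in>Pow {..<k}. k * \<delta>)" .
  have "\<exists>A\<in>Pow {..<k}. norm (\<Sum>i<k. rademacher A i *\<^sub>R v i) \<le> k * \<delta>"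
  proof (rule ccontr)
    assume "\<not> ?thesis"
    then have "(\<Sum>A\<in>Pow {..<k}. k * \<delta>) < (\<Sum>A\<in>Pow {..<k}. norm (\<Sum>i<k. rademacher A i *\<^sub>R v i))"
      by (intro sum_strict_mono) (auto simp: not_le)
    then show False using avg by linarith
  qed
  then obtain A where A: "norm (\<Sum>i<k. rademacher A i *\<^sub>R v i) \<le> k * \<delta>" by blast
  have "K n ((1 / real k) *\<^sub>R (\<Sum>i<k. rademacher A i *\<^sub>R v i)) \<le> \<eta>" if "n \<le> M" for n
  proof -
    have "norm ((1 / real k) *\<^sub>R (\<Sum>i<k. rademacher A i *\<^sub>R v i)) \<le> \<delta>"
      using A \<open>0 < k\<close> by (simp add: field_simps)
    then have "K n ((1 / real k) *\<^sub>R (\<Sum>i<k. rademacher A i *\<^sub>R v i)) \<le> 2 ^ n * \<delta>"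
      by (meson K_le_norm mult_left_mono order_trans zero_le_numeral zero_le_power)
    also have "\<dots> \<le> 2 ^ M * \<delta>" using that \<open>0 < \<delta>\<close> by (intro mult_right_mono power_increasing) auto
    finally show ?thesis by (simp add: \<delta>_def)
  qed
  then show ?thesis using \<open>0 < k\<close> by blast
qed

text \<open>A gliding hump: each new average is small at the levels where the sum so far is not.\<close>
lemma no_ell1_sequence:
  assumes v: "\<And>i. v i \<in> V" "\<And>i. N (v i) \<le> C" and "0 < c"
    and lower: "\<And>(b :: nat \<Rightarrow> real) s. c * (\<Sum>i<s. \<bar>b i\<bar>) \<le> N (\<Sum>i<s. b i *\<^sub>R v i)"
  shows False
proof -
  \<comment> \<open>Half of the lower constant: each block adds 1 to the total weight but only
    \<open>c / 2\<close> to the bound on the norm, against the required \<open>c\<close>.\<close>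
  define \<eta> where "\<eta> = c / 2"
  have "0 < \<eta>" using assms by (simp add: \<eta>_def)
  have KC: "K n (v i) \<le> C" for n i using K_le_N[OF v(1)] v(2) order_trans by blast
  have "0 \<le> C" using KC[of 0 0] K_nonneg order_trans by blast
  have "\<exists>(b :: nat \<Rightarrow> real) s. (\<Sum>i<s. \<bar>b i\<bar>) = real L \<and> (\<forall>n. K n (\<Sum>i<s. b i *\<^sub>R v i) \<le> L * \<eta> + C)" for L
  proof (induction L)
    case 0
    show ?case using \<open>0 \<le> C\<close> by (intro exI[of _ "\<lambda>_. 0"] exI[of _ 0]) simp
  next
    case (Suc L)
    then obtain b s where b: "(\<Sum>i<s. \<bar>b i\<bar>) = real L"
      and Kb: "\<And>n. K n (\<Sum>i<s. b i *\<^sub>R v i) \<le> L * \<eta> + C" by blast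
    define y where "y = (\<Sum>i<s. b i *\<^sub>R v i)"
    have "y \<in> V" unfolding y_def
      by (intro subspace_sum[OF subspace_V] subspace_scale[OF subspace_V] v)
    then have "\<forall>\<^sub>F n in sequentially. K n y < \<eta>"
      using \<open>0 < \<eta>\<close> unfolding V_def by (auto intro: order_tendstoD)
    then obtain M where M: "\<And>n. n \<ge> M \<Longrightarrow> K n y < \<eta>" by (auto simp: eventually_sequentially)
    obtain k A where "0 < k"
      and small: "\<And>n. n \<le> M \<Longrightarrow> K n ((1 / real k) *\<^sub>R (\<Sum>i<k. rademacher A i *\<^sub>R v (s + i))) \<le> \<eta>"
      using small_rademacher_average[of "\<lambda>i. v (s + i)" C \<eta> M] v \<open>0 < \<eta>\<close> by blast
    define u where "u = (1 / real k) *\<^sub>R (\<Sum>i<k. rademacher A i *\<^sub>R v (s + i))"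
    have u_le: "K n u \<le> C" for n
    proof -
      have "K n (\<Sum>i<k. rademacher A i *\<^sub>R v (s + i)) \<le> (\<Sum>i<k. K n (rademacher A i *\<^sub>R v (s + i)))"
        by (rule K_sum_le)
      also have "\<dots> \<le> (\<Sum>i<k. C)" by (intro sum_mono) (simp add: K_scaleR KC)
      finally show ?thesis using \<open>0 < k\<close> by (simp add: u_def K_scaleR field_simps)
    qed
    define b' where "b' i = (if i < s then b i else rademacher A (i - s) / real k)" for i
    have "(\<Sum>i<s + k. \<bar>b' i\<bar>) = real (Suc L)"
      using \<open>0 < k\<close> b by (simp add: sum_lessThan_add b'_def)
    moreover have "(\<Sum>i<s + k. b' i *\<^sub>R v i) = y + u"
      by (simp add: sum_lessThan_add b'_def y_def u_def scaleR_sum_right)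
    \<comment> \<open>Up to level \<open>M\<close> the new block \<open>u\<close> is small. Beyond
      \<open>M\<close> the old sum \<open>y\<close> is small, and the constant \<open>C\<close> pays
      for \<open>u\<close>.\<close>
    moreover have "K n (y + u) \<le> Suc L * \<eta> + C" for n
    proof (cases "n \<le> M")
      case True
      then show ?thesis
        using K_add[of n y u] Kb[of n] small[of n] by (simp add: y_def u_def algebra_simps)
    next
      case False
      then have "K n y < \<eta>" using M by simp
      moreover have "0 \<le> L * \<eta>" using \<open>0 < \<eta>\<close> by simp
      ultimately show ?thesis using K_add[of n y u] u_le[of n] by (simp add: algebra_simps)
    qed
    ultimately show ?case by (intro exI[of _ b'] exI[of _ "s + k"]) simp
  qed
  then have "c * real L \<le> L * \<eta> + C" for L
    by (metis lower N_le order_trans)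
  then have "real L * \<eta> \<le> C" for L by (simp add: \<eta>_def field_simps)
  moreover obtain L :: nat where "C / \<eta> < real L" using reals_Archimedean2 by blast
  ultimately show False using \<open>0 < \<eta>\<close> by (simp add: field_simps) (meson not_le)
qed

lemma not_contains_ell1_V: "\<not> contains_ell1 V N"
proof
  assume "contains_ell1 V N"
  then obtain T :: "(nat \<Rightarrow> real) \<Rightarrow> 'e" where TV: "T ` ell1 \<subseteq> V"
    and add: "\<forall>x\<in>ell1. \<forall>y\<in>ell1. T (\<lambda>n. x n + y n) = T x + T y"
    and scale: "\<forall>a. \<forall>x\<in>ell1. T (\<lambda>n. a * x n) = a *\<^sub>R T x"
    and "\<exists>c C. 0 < c \<and> (\<forall>x\<in>ell1. c * ell1_norm x \<le> N (T x) \<and> N (T x) \<le> C * ell1_norm x)"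
    unfolding contains_ell1_def by blast
  then obtain c C where "0 < c" and lower: "\<And>x. x \<in> ell1 \<Longrightarrow> c * ell1_norm x \<le> N (T x)"
    and upper: "\<And>x. x \<in> ell1 \<Longrightarrow> N (T x) \<le> C * ell1_norm x"
    by blast
  define e where "e i = (\<lambda>n. if n = i then 1 else 0 :: real)" for i :: nat
  have fin: "(\<lambda>n. if n < s then b n else 0) \<in> ell1"
      "ell1_norm (\<lambda>n. if n < s then b n else 0) = (\<Sum>n<s. \<bar>b n\<bar>)" for b :: "nat \<Rightarrow> real" and s
  proof -
    have "(\<lambda>n. \<bar>if n < s then b n else 0\<bar>) sums (\<Sum>n<s. \<bar>if n < s then b n else 0\<bar>)"
      by (rule sums_finite) auto
    then show "(\<lambda>n. if n < s then b n else 0) \<in> ell1"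
      "ell1_norm (\<lambda>n. if n < s then b n else 0) = (\<Sum>n<s. \<bar>b n\<bar>)"
      by (auto simp: ell1_def ell1_norm_def sums_iff)
  qed
  have e: "e i \<in> ell1" "ell1_norm (e i) = 1" for i
  proof -
    have "(\<lambda>n. \<bar>e i n\<bar>) sums (\<Sum>n\<in>{i}. \<bar>e i n\<bar>)" by (rule sums_finite) (auto simp: e_def)
    then show "e i \<in> ell1" "ell1_norm (e i) = 1" by (auto simp: ell1_def ell1_norm_def sums_iff e_def)
  qed
  have T_fin: "T (\<lambda>n. if n < s then b n else 0) = (\<Sum>i<s. b i *\<^sub>R T (e i))" for b s
  proof (induction s)
    case 0
    show ?case using scale[rule_format, of "e 0" 0] e(1) by simp
  next
    case (Suc s)
    have "(\<lambda>n. if n < Suc s then b n else 0) = (\<lambda>n. (if n < s then b n else 0) + b s * e s n)"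
      by (auto simp: e_def fun_eq_iff less_Suc_eq)
    moreover have "(\<lambda>n. b s * e s n) \<in> ell1"
      using e(1)[of s] by (auto simp: ell1_def abs_mult intro: summable_mult)
    ultimately show ?case using Suc add[rule_format, OF fin(1)] scale[rule_format, OF e(1)] by simp
  qed
  show False
  proof (rule no_ell1_sequence[of "\<lambda>i. T (e i)" C c])
    show "T (e i) \<in> V" "N (T (e i)) \<le> C" for i using TV e upper[of "e i"] by auto
    show "c * (\<Sum>i<s. \<bar>b i\<bar>) \<le> N (\<Sum>i<s. b i *\<^sub>R T (e i))" for b s
      using lower[OF fin(1)[of s b]] by (simp add: fin T_fin)
  qed (rule \<open>0 < c\<close>)
qed

lemma rosenthal_V: "rosenthal_space_on V N"
  using banach_V not_contains_ell1_V by (simp add: rosenthal_space_on_def)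

section \<open>Isometries that preserve the generating set\<close>

lemma K_isometry_le:
  assumes "linear U" "\<And>v. norm (U v) = norm v" "U ` F \<subseteq> F"
  shows "K n (U f) \<le> K n f"
proof -
  have "convex (U -` W)" using assms(1) convex_W by (rule convex_linear_vimage)
  then have "W \<subseteq> U -` W"
    unfolding W_def using assms(3) by (intro hull_minimal) (auto intro: hull_inc)
  then show ?thesis
    using K_image_le[of U 1 n f] assms(1,2) by (auto simp: linear_diff linear_scale)
qed

text \<open>Equal values of \<open>K n\<close>, as along an orbit, make the high levels of
  \<open>u\<close> and \<open>v\<close> small together; the finitely many low levels are controlled
  by the norm. Thus on orbits continuity in the weaker norm gives continuity in
  \<open>N\<close>.\<close>

lemma N_diff_le_of_norm_diff:
  assumes "v \<in> V" "0 < e"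
  shows "\<exists>\<delta>>0. \<forall>u. (\<forall>n. K n u = K n v) \<and> norm (u - v) < \<delta> \<longrightarrow> N (u - v) < e"
proof -
  have "\<forall>\<^sub>F n in sequentially. K n v < e / 4"
    using assms order_tendstoD(2)[of "\<lambda>n. K n v" 0 sequentially "e / 4"] unfolding V_def by simp
  then obtain M where M: "\<And>n. n \<ge> M \<Longrightarrow> K n v < e / 4" by (auto simp: eventually_sequentially)
  have "N (u - v) < e" if u: "\<forall>n. K n u = K n v" "norm (u - v) < e / 2 / 2 ^ M" for u
  proof -
    have "K n (u - v) \<le> e / 2" for n
    proof (cases "n \<ge> M")
      case True
      then show ?thesis using K_diff[of n u v] u(1) M[of n] by simp
    next
      case False
      have "K n (u - v) \<le> 2 ^ n * norm (u - v)" by (rule K_le_norm)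
      also have "\<dots> \<le> 2 ^ M * norm (u - v)" using False by (intro mult_right_mono power_increasing) auto
      also have "\<dots> \<le> e / 2" using u(2) by (simp add: field_simps)
      finally show ?thesis .
    qed
    then have "N (u - v) \<le> e / 2" by (rule N_le)
    then show ?thesis using assms(2) by linarith
  qed
  then show ?thesis using assms(2) by (intro exI[of _ "e / 2 / 2 ^ M"]) auto
qed

end


section \<open>The representation\<close>

text \<open>The library's completeness instance for this type requires a metric domain.\<close>
lemma Cauchy_bcontfun_convergent:
  fixes \<sigma> :: "nat \<Rightarrow> 'a::topological_space \<Rightarrow>\<^sub>C 'b::complete_space"
  assumes "Cauchy \<sigma>"
  shows "convergent \<sigma>"
proof -
  obtain g where "uniform_limit UNIV (\<lambda>i. apply_bcontfun (\<sigma> i)) g sequentially"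
    using uniformly_convergent_eq_cauchy[of "\<lambda>_. True" "\<lambda>i. apply_bcontfun (\<sigma> i)"] assms
    unfolding Cauchy_def uniform_limit_sequentially_iff
    by (metis dist_fun_lt_imp_dist_val_lt)
  from uniform_limit_bcontfunE[OF this sequentially_bot]
  show ?thesis by (metis convergentI)
qed

section \<open>Tameness by counting cells\<close>

context median_algebra
begin

lemma halfspace_vimage:
  assumes "\<And>x y z. \<phi> (m x y z) = m (\<phi> x) (\<phi> y) (\<phi> z)" "halfspace H"
  shows "halfspace (\<phi> -` H)"
  using assms cvxD(1) unfolding halfspace_def cvx_def by (simp add: vimage_def)

end

context finite_rank_compact_median_algebra
begin

text \<open>The pairs with a gap of at least \<open>\<delta>\<close> form a compact set off the
  diagonal, so finitely many separating halfspaces cover it. This brings an arbitrary continuous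
  function within reach of \<open>halfspace_pattern_net\<close>.\<close>

lemma halfspace_cover:
  fixes f :: "'x \<Rightarrow> real"
  assumes "continuous_on UNIV f" "0 < \<delta>"
  shows "\<exists>\<H>. finite \<H> \<and> (\<forall>H\<in>\<H>. halfspace H) \<and>
    (\<forall>x y. \<delta> \<le> f y - f x \<longrightarrow> (\<exists>H\<in>\<H>. x \<in> H \<and> y \<notin> H))"
proof -
  define S where "S = {p. \<delta> \<le> f (snd p) - f (fst p)}"
  have "continuous_on UNIV (\<lambda>p. f (snd p) - f (fst p))"
    using assms(1) by (intro continuous_intros continuous_on_compose2[OF assms(1)]) auto
  then have "closed S"
    unfolding S_def by (intro closed_Collect_le) (auto intro: continuous_intros)
  moreover have "compact (UNIV :: ('x \<times> 'x) set)" using compact_Times[OF compact compact] by simp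
  ultimately have "compact S" using closed_Int_compact[of S UNIV] by simp
  have cover: "S \<subseteq> (\<Union>H\<in>Collect halfspace. interior H \<times> - closure H)"
  proof clarify
    fix x y assume "(x, y) \<in> S"
    then have "x \<noteq> y" using assms(2) by (auto simp: S_def)
    then obtain H where "halfspace H" "x \<in> interior H" "y \<notin> closure H" using point_separation by blast
    then show "(x, y) \<in> (\<Union>H\<in>Collect halfspace. interior H \<times> - closure H)" by blast
  qed
  have "open (interior H \<times> - closure H)" for H :: "'x set" by (auto intro: open_Times)
  from compactE_image[OF \<open>compact S\<close> this cover]
  obtain \<H> where \<H>: "\<H> \<subseteq> Collect halfspace" "finite \<H>"
    "S \<subseteq> (\<Union>H\<in>\<H>. interior H \<times> - closure H)" .
  have "\<exists>H\<in>\<H>. x \<in> H \<and> y \<notin> H" if "\<delta> \<le> f y - f x" for x y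
  proof -
    have "(x, y) \<in> S" using that by (simp add: S_def)
    then obtain H where "H \<in> \<H>" "x \<in> interior H" "y \<notin> closure H" using \<H>(3) by auto
    then show ?thesis using interior_subset[of H] closure_subset[of H] by blast
  qed
  then show ?thesis using \<H> by blast
qed

text \<open>The points realising the \<open>2 ^ k\<close> sign patterns of an independent family lie in distinct cells
  of polynomially many halfspaces.\<close>
lemma no_independent_automorphisms:
  fixes f :: "'x \<Rightarrow> real"
  assumes "continuous_on UNIV f" and \<phi>: "\<And>i x y z. \<phi> i (m x y z) = m (\<phi> i x) (\<phi> i y) (\<phi> i z)"
  shows "\<not> independent_seq (\<lambda>i x. f (\<phi> i x))"
proof
  assume "independent_seq (\<lambda>i x. f (\<phi> i x))"
  then obtain a b where "a < b" and ind: "\<forall>P M. finite P \<and> finite M \<and> P \<inter> M = {} \<longrightarrow>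
        (\<Inter>i\<in>P. (\<lambda>x. f (\<phi> i x)) -` {..a}) \<inter> (\<Inter>j\<in>M. (\<lambda>x. f (\<phi> j x)) -` {b..}) \<noteq> {}"
    unfolding independent_seq_def by (elim exE conjE)
  obtain \<H> where \<H>: "finite \<H>" "\<And>H. H \<in> \<H> \<Longrightarrow> halfspace H"
    "\<And>x y. b - a \<le> f y - f x \<Longrightarrow> \<exists>H\<in>\<H>. x \<in> H \<and> y \<notin> H"
    using halfspace_cover[OF assms(1), of "b - a"] \<open>a < b\<close> by auto
  have nat_le: "2 ^ k \<le> (card \<H> * k + 1) ^ n" for k
  proof -
    define I where "I = \<H> \<times> {..<k}"
    \<comment> \<open>Preimages of halfspaces under the maps \<open>\<phi> i\<close> are halfspaces
      again, and \<open>k\<close> maps produce only \<open>card \<H> * k\<close> of them.\<close>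
    define C where "C = (\<lambda>(H, i). \<phi> i -` H)"
    have "finite I" using \<H>(1) by (simp add: I_def)
    have halfC: "halfspace (C p)" if "p \<in> I" for p
      using that halfspace_vimage[of "\<phi> (snd p)" "fst p", OF \<phi>] \<H>(2) by (auto simp: C_def I_def)
    have "\<exists>R. finite R \<and> card R \<le> (card I + 1) ^ n \<and> (\<forall>x. \<exists>r\<in>R. \<forall>p\<in>I. x \<in> C p \<longleftrightarrow> r \<in> C p)"
      by (rule halfspace_pattern_net[OF rank \<open>finite I\<close> halfC])
    then obtain R where R: "finite R" "card R \<le> (card I + 1) ^ n"
      "\<forall>x. \<exists>r\<in>R. \<forall>p\<in>I. x \<in> C p \<longleftrightarrow> r \<in> C p"
      by (elim exE conjE)
    have "\<exists>x. (\<forall>i\<in>P. f (\<phi> i x) \<le> a) \<and> (\<forall>j\<in>{..<k} - P. b \<le> f (\<phi> j x))" if "P \<subseteq> {..<k}" for P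
    proof -
      have "(\<Inter>i\<in>P. (\<lambda>x. f (\<phi> i x)) -` {..a}) \<inter> (\<Inter>j\<in>{..<k} - P. (\<lambda>x. f (\<phi> j x)) -` {b..}) \<noteq> {}"
        using ind[rule_format, of P "{..<k} - P"] finite_subset[OF that] by auto
      then obtain x where "x \<in> (\<Inter>i\<in>P. (\<lambda>x. f (\<phi> i x)) -` {..a}) \<inter> (\<Inter>j\<in>{..<k} - P. (\<lambda>x. f (\<phi> j x)) -` {b..})"
        by blast
      then show ?thesis by (intro exI[of _ x]) auto
    qed
    then obtain x where x: "\<And>P. P \<subseteq> {..<k} \<Longrightarrow>
        (\<forall>i\<in>P. f (\<phi> i (x P)) \<le> a) \<and> (\<forall>j\<in>{..<k} - P. b \<le> f (\<phi> j (x P)))"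
      by metis
    from choice[OF R(3)[unfolded Bex_def]]
    obtain \<rho> where \<rho>: "\<forall>x. \<rho> x \<in> R \<and> (\<forall>p\<in>I. x \<in> C p \<longleftrightarrow> \<rho> x \<in> C p)" ..
    define r where "r P = \<rho> (x P)" for P
    have r: "r P \<in> R" "\<forall>p\<in>I. x P \<in> C p \<longleftrightarrow> r P \<in> C p" for P
      using spec[OF \<rho>, of "x P"] unfolding r_def by (rule conjunct1, rule conjunct2)
    have sub: "P \<subseteq> Q" if PQ: "P \<subseteq> {..<k}" "Q \<subseteq> {..<k}" "r P = r Q" for P Q
    proof
      fix i assume "i \<in> P"
      show "i \<in> Q"
      proof (rule ccontr)
        assume "i \<notin> Q"
        then have "b \<le> f (\<phi> i (x Q))" using x[OF PQ(2)] PQ(1) \<open>i \<in> P\<close> by auto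
        moreover have "f (\<phi> i (x P)) \<le> a" using x[OF PQ(1)] \<open>i \<in> P\<close> by auto
        ultimately have "b - a \<le> f (\<phi> i (x Q)) - f (\<phi> i (x P))" by linarith
        then obtain H where H: "H \<in> \<H>" "\<phi> i (x P) \<in> H" "\<phi> i (x Q) \<notin> H" using \<H>(3) by blast
        then have "(H, i) \<in> I" using PQ(1) \<open>i \<in> P\<close> by (auto simp: I_def)
        then have "x P \<in> C (H, i) \<longleftrightarrow> x Q \<in> C (H, i)" using r(2) PQ(3) by auto
        then show False using H by (simp add: C_def)
      qed
    qed
    have "inj_on r (Pow {..<k})"
      by (rule inj_onI) (use sub in \<open>simp add: subset_antisym\<close>)
    then have "card (Pow {..<k}) \<le> card R" using R(1) r(1) by (intro card_inj_on_le[of r]) auto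
    then show ?thesis using R(2) by (simp add: card_Pow I_def card_cartesian_product)
  qed
  have le: "2 ^ k \<le> (real (card \<H>) * real k + 1) ^ n" for k
    using of_nat_mono[OF nat_le[of k], where 'a = real] by (simp add: add.commute)
  have "(\<lambda>k. (real (card \<H>) * real k + 1) ^ n / 2 ^ k) \<longlonglongrightarrow> 0"
  proof (cases "card \<H> = 0")
    case True
    have "(\<lambda>k. 1 / 2 ^ k :: real) \<longlonglongrightarrow> 0" by real_asymp
    then show ?thesis using True by simp
  next
    case False
    then have "0 < real (card \<H>)" by simp
    then show ?thesis by real_asymp
  qed
  then have "\<forall>\<^sub>F k in sequentially. (real (card \<H>) * real k + 1) ^ n / 2 ^ k < 1"
    by (intro order_tendstoD) auto
  then obtain k where "(real (card \<H>) * real k + 1) ^ n / 2 ^ k < 1"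
    by (auto simp: eventually_sequentially)
  then show False using le[of k] by (simp add: field_simps)
qed

sublocale interpolation atoms
proof
  show "convergent \<sigma>" if "Cauchy \<sigma>" for \<sigma> :: "nat \<Rightarrow> 'x \<Rightarrow>\<^sub>C real"
    using that by (rule Cauchy_bcontfun_convergent)
  show "rademacher_averages_vanish atoms" by (rule rademacher_averages_vanish_atoms)
  show "norm f \<le> 1" if f: "f \<in> atoms" for f
  proof (rule norm_bound)
    fix x
    obtain h where "halfspace_function (apply_bcontfun h)" "f = h \<or> f = - h"
      using f unfolding atoms_def by blast
    then show "norm (apply_bcontfun f x) \<le> 1"
      using range_subsetD[of "apply_bcontfun h" "{0..1}" x] by (auto simp: halfspace_function_def)
  qed
  show "- f \<in> atoms" if "f \<in> atoms" for f
    using that unfolding atoms_def by auto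
  have "halfspace_function (\<lambda>x. 0)"
    unfolding halfspace_function_def by (auto simp: halfspace_def cvx_def)
  then show "0 \<in> atoms" unfolding atoms_def by (auto intro!: exI[of _ 0])
qed

section \<open>Points as evaluation functionals\<close>

lemma bcontfun_continuous: "continuous_on UNIV (f :: 'x \<Rightarrow> real) \<Longrightarrow> f \<in> bcontfun"
  unfolding bcontfun_def using compact_continuous_image[OF _ compact] compact_imp_bounded by blast

lemma V_separates:
  assumes "x \<noteq> y"
  shows "\<exists>v\<in>V. apply_bcontfun v x \<noteq> apply_bcontfun v y"
proof -
  obtain f where f: "halfspace_function f" "f x \<noteq> f y"
    using halfspace_function_separation[OF assms] by blast
  then have eq: "apply_bcontfun (Bcontfun f) = f"
    by (simp add: halfspace_function_def bcontfun_continuous Bcontfun_inverse)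
  then have "Bcontfun f \<in> atoms" unfolding atoms_def using f(1) by (auto intro: exI[of _ "Bcontfun f"])
  then show ?thesis using F_subset_V f(2) eq by (metis subsetD)
qed

definition evaluation :: "'x \<Rightarrow> ('x \<Rightarrow>\<^sub>C real) \<Rightarrow> real" where
  "evaluation x = (\<lambda>v\<in>V. apply_bcontfun v x)"

lemma evaluation_dual_ball: "evaluation x \<in> dual_ball V N"
proof -
  have le: "\<bar>apply_bcontfun v x\<bar> \<le> N v" if "v \<in> V" for v
    using norm_bounded[of v x] norm_le_N[OF that] by simp
  have "linear_map_on V (evaluation x)"
    unfolding linear_map_on_def evaluation_def
    using subspace_add[OF subspace_V] subspace_scale[OF subspace_V] by simp
  moreover have "\<bar>evaluation x v\<bar> \<le> 1 * N v" if "v \<in> V" for v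
    using le[OF that] that by (simp add: evaluation_def)
  moreover have "evaluation x \<in> extensional V" by (simp add: evaluation_def)
  ultimately have "evaluation x \<in> dual V N"
    unfolding dual_def by blast
  then show ?thesis unfolding dual_ball_def using le by (simp add: evaluation_def)
qed

text \<open>A continuous injection of a compact space into a Hausdorff space is an embedding.
  \<open>S\<close> is left open to serve both the dual and its unit ball.\<close>

lemma evaluation_embedding:
  assumes "range evaluation \<subseteq> S"
  shows "embedding_map euclidean (subtopology (product_topology (\<lambda>_. euclideanreal) V) S) evaluation"
proof (rule continuous_imp_embedding_map)
  show "compact_space (euclidean :: 'x topology)"
    using compact by (simp add: compact_space_def)
  show "Hausdorff_space (subtopology (product_topology (\<lambda>_. euclideanreal) V) S)"
    by (intro Hausdorff_space_subtopology) (simp add: Hausdorff_space_product_topology)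
  have "continuous_map euclidean euclideanreal (\<lambda>x. evaluation x v)" if "v \<in> V" for v
    using that by (simp add: evaluation_def)
  then show "continuous_map euclidean (subtopology (product_topology (\<lambda>_. euclideanreal) V) S) evaluation"
    using assms unfolding continuous_map_in_subtopology continuous_map_componentwise
    by (auto simp: evaluation_def)
  show "inj_on evaluation (topspace euclidean)"
  proof (rule inj_onI, rule ccontr)
    fix x y assume "evaluation x = evaluation y" "x \<noteq> y"
    then show False using V_separates[of x y] unfolding evaluation_def by (metis restrict_apply')
  qed
qed

end

section \<open>The group action\<close>

locale median_action = finite_rank_compact_median_algebra m n
  for m :: "'x::t2_space \<Rightarrow> 'x \<Rightarrow> 'x \<Rightarrow> 'x" and n +
  fixes act :: "'g::topological_group_add \<Rightarrow> 'x \<Rightarrow> 'x"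
  assumes action: "continuous_action act" and preserving: "median_preserving m act"
begin

lemma act_zero [simp]: "act 0 x = x" and act_add: "act (g + k) x = act g (act k x)"
  and act_continuous: "continuous_on UNIV (\<lambda>(g, x). act g x)"
  using action unfolding continuous_action_def by auto

lemma act_median: "act g (m x y z) = m (act g x) (act g y) (act g z)"
  using preserving unfolding median_preserving_def by blast

lemma act_continuous_point: "continuous_on UNIV (act g)"
  using continuous_on_compose2[OF act_continuous, of UNIV "\<lambda>x. (g, x)"] by (simp add: continuous_on_Pair)

lemma tame: "tame_system act"
  unfolding tame_system_def
proof (intro allI impI notI, elim exE conjE)
  fix f :: "'x \<Rightarrow> real" and F
  assume f: "continuous_on UNIV f" and "range F \<subseteq> range (\<lambda>g x. f (act g x))" and ind: "independent_seq F"
  then have "\<forall>i. \<exists>g. F i = (\<lambda>x. f (act g x))" by blast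
  then obtain g where "F = (\<lambda>i x. f (act (g i) x))" by metis
  then show False using no_independent_automorphisms[OF f, of "\<lambda>i. act (g i)"] ind act_median by simp
qed

text \<open>The inverse makes this a left action of a group that need not be commutative; it cancels
  against the inverse in the dual action, so evaluations are equivariant.\<close>

definition translate :: "'g \<Rightarrow> ('x \<Rightarrow>\<^sub>C real) \<Rightarrow> 'x \<Rightarrow>\<^sub>C real" where
  "translate g f = Bcontfun (\<lambda>x. apply_bcontfun f (act (- g) x))"

lemma translate_apply [simp]: "apply_bcontfun (translate g f) x = apply_bcontfun f (act (- g) x)"
proof -
  have "continuous_on UNIV (\<lambda>x. apply_bcontfun f (act (- g) x))"
    using continuous_on_compose2[OF continuous_on_apply_bcontfun act_continuous_point] by blast
  then show ?thesis unfolding translate_def by (simp add: bcontfun_continuous Bcontfun_inverse)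
qed

lemma translate_add: "translate (g + k) f = translate g (translate k f)"
  by (rule bcontfun_eqI) (simp only: translate_apply minus_add act_add)

lemma translate_inverse [simp]: "translate (- g) (translate g f) = f" "translate g (translate (- g) f) = f"
  by (rule bcontfun_eqI, simp flip: act_add)+

lemma linear_translate: "linear (translate g)"
  by (rule linearI; rule bcontfun_eqI) auto

lemma norm_translate [simp]: "norm (translate g f) = norm f"
proof (rule antisym)
  have le: "norm (translate g f) \<le> norm f" for g f
    using norm_bounded[of f] by (intro norm_bound) simp
  show "norm (translate g f) \<le> norm f" by (rule le)
  show "norm f \<le> norm (translate g f)" using le[of "- g" "translate g f"] by simp
qed

lemma translate_atoms: "translate g ` atoms \<subseteq> atoms"
proof clarify
  fix f assume "f \<in> atoms"
  then obtain h where h: "halfspace_function (apply_bcontfun h)" "f = h \<or> f = - h"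
    unfolding atoms_def by blast
  have "halfspace {x. apply_bcontfun (translate g h) x < t}" for t
    using halfspace_vimage[of "act (- g)" "{x. apply_bcontfun h x < t}"] h(1) act_median
    by (simp add: halfspace_function_def vimage_def)
  moreover have "range (apply_bcontfun (translate g h)) \<subseteq> {0..1}"
    using h(1) by (auto simp: halfspace_function_def dest: range_subsetD)
  ultimately have "halfspace_function (apply_bcontfun (translate g h))"
    unfolding halfspace_function_def by blast
  moreover have "translate g f = translate g h \<or> translate g f = - translate g h"
    using h(2) linear_neg[OF linear_translate] by auto
  ultimately show "translate g f \<in> atoms" unfolding atoms_def by blast
qed

lemma K_translate [simp]: "K l (translate g f) = K l f"
proof (rule antisym)
  have le: "K l (translate g f) \<le> K l f" for g f
    by (rule K_isometry_le[OF linear_translate norm_translate translate_atoms])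
  show "K l (translate g f) \<le> K l f" by (rule le)
  show "K l f \<le> K l (translate g f)" using le[of "- g" "translate g f"] by simp
qed

lemma translate_V [simp]: "translate g v \<in> V \<longleftrightarrow> v \<in> V"
  by (simp add: V_def)

lemma N_translate [simp]: "N (translate g v) = N v"
  by (simp add: N_def)

definition rep :: "'g \<Rightarrow> ('x \<Rightarrow>\<^sub>C real) \<Rightarrow> 'x \<Rightarrow>\<^sub>C real" where
  "rep g = (\<lambda>v\<in>V. translate g v)"

lemma rep_Iso: "rep g \<in> Iso V N"
proof -
  have "rep g ` V = V"
  proof
    show "V \<subseteq> rep g ` V"
    proof
      fix v assume "v \<in> V"
      then show "v \<in> rep g ` V"
        by (intro image_eqI[of _ _ "translate (- g) v"]) (simp_all add: rep_def)
    qed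
  qed (auto simp: rep_def)
  moreover have "linear_map_on V (rep g)"
    unfolding linear_map_on_def rep_def
    using subspace_add[OF subspace_V] subspace_scale[OF subspace_V]
      linear_add[OF linear_translate] linear_scale[OF linear_translate] by simp
  ultimately show ?thesis unfolding Iso_def by (auto simp: rep_def)
qed

text \<open>Joint continuity and compactness of the space: a neighbourhood of the slice over
  \<open>g0\<close> contains a whole tube, which makes the estimate uniform in the point.\<close>

lemma translate_norm_continuous:
  assumes "0 < e"
  shows "\<exists>U. open U \<and> g0 \<in> U \<and> (\<forall>g\<in>U. norm (translate g v - translate g0 v) < e)"
proof -
  define W where "W = {p. \<bar>apply_bcontfun v (act (- fst p) (snd p)) - apply_bcontfun v (act (- g0) (snd p))\<bar> < e / 2}"
  have "continuous_on UNIV (\<lambda>p. act (- fst p) (snd p))"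
    using continuous_on_compose2[OF act_continuous, of UNIV "\<lambda>p. (- fst p, snd p)"]
    by (simp add: continuous_on_Pair continuous_on_minus continuous_on_fst continuous_on_snd)
  moreover have "continuous_on UNIV (\<lambda>p :: 'g \<times> 'x. act (- g0) (snd p))"
    using continuous_on_compose2[OF act_continuous_point continuous_on_snd[OF continuous_on_id]] by auto
  ultimately have "continuous_on UNIV
    (\<lambda>p. \<bar>apply_bcontfun v (act (- fst p) (snd p)) - apply_bcontfun v (act (- g0) (snd p))\<bar>)"
    using continuous_on_compose2[OF continuous_on_apply_bcontfun] by (intro continuous_intros) auto
  then have "open W" unfolding W_def by (intro open_Collect_less) auto
  moreover have "{g0} \<times> UNIV \<subseteq> W" using assms by (auto simp: W_def)
  ultimately obtain U U' where U: "open U" "{g0} \<subseteq> U" "UNIV \<subseteq> U'" "U \<times> U' \<subseteq> W"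
    using Wallace_open[OF compact_sing compact] by metis
  have "norm (translate g v - translate g0 v) < e" if "g \<in> U" for g
  proof -
    have "norm (translate g v - translate g0 v) \<le> e / 2"
    proof (rule norm_bound)
      fix x
      have "(g, x) \<in> W" using U that by blast
      then show "norm (apply_bcontfun (translate g v - translate g0 v) x) \<le> e / 2"
        by (simp add: W_def)
    qed
    then show ?thesis using assms by simp
  qed
  then show ?thesis using U by blast
qed

lemma rep_continuous: "continuous_hom_Iso V N rep"
  unfolding continuous_hom_Iso_def
proof (intro conjI allI)
  show "rep g \<in> Iso V N" for g by (rule rep_Iso)
  show "rep (g + k) = compose V (rep g) (rep k)" for g k
    by (auto simp: fun_eq_iff compose_def rep_def translate_add)
  have "continuous_map euclidean (norm_topology V N) (\<lambda>g. rep g v)" if v: "v \<in> V" for v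
    unfolding norm_topology_def V.continuous_map_to_metric
  proof (intro ballI allI impI)
    fix g0 and e :: real assume "0 < e"
    \<comment> \<open>All translates of \<open>v\<close> share the values of \<open>K l\<close>, so
      closeness in the supremum norm yields closeness in \<open>N\<close>.\<close>
    obtain \<delta> where \<delta>: "\<delta> > 0"
      "\<And>u. (\<And>l. K l u = K l (translate g0 v)) \<Longrightarrow> norm (u - translate g0 v) < \<delta> \<Longrightarrow> N (u - translate g0 v) < e"
      using N_diff_le_of_norm_diff[of "translate g0 v" e] v \<open>0 < e\<close> by auto
    obtain U where U: "open U" "g0 \<in> U" "\<And>g. g \<in> U \<Longrightarrow> norm (translate g v - translate g0 v) < \<delta>"
      using translate_norm_continuous[OF \<delta>(1)] by metis
    have "rep g v \<in> V.mball (rep g0 v) e" if "g \<in> U" for g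
    proof -
      have "N (translate g v - translate g0 v) < e" using \<delta>(2)[of "translate g v"] U(3)[OF that] by simp
      then have "N (translate g0 v - translate g v) < e"
        using N_uminus[of "translate g v - translate g0 v"] by simp
      then show ?thesis using v by (simp add: rep_def norm_dist_def)
    qed
    then show "\<exists>U. openin euclidean U \<and> g0 \<in> U \<and> (\<forall>g\<in>U. rep g v \<in> V.mball (rep g0 v) e)"
      using U by auto
  qed
  then show "continuous_map euclidean (strong_operator_topology V N) rep"
    unfolding strong_operator_topology_def continuous_map_in_subtopology continuous_map_componentwise
    using rep_Iso by (auto simp: rep_def)
qed

lemma evaluation_equivariant: "equivariant act (dual_action V rep) evaluation"
  unfolding equivariant_def
proof (intro allI ext)
  fix g x v
  show "evaluation (act g x) v = dual_action V rep g (evaluation x) v"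
  proof (cases "v \<in> V")
    case True
    have "inj_on (rep g) V"
    proof (rule inj_onI)
      fix u w assume "u \<in> V" "w \<in> V" "rep g u = rep g w"
      then have "translate (- g) (translate g u) = translate (- g) (translate g w)" by (simp add: rep_def)
      then show "u = w" by simp
    qed
    then have "inv_into V (rep g) v = translate (- g) v"
      using True by (intro inv_into_f_eq) (simp_all add: rep_def)
    then show ?thesis using True by (simp add: evaluation_def dual_action_def)
  qed (simp add: evaluation_def dual_action_def)
qed

lemma representable: "rosenthal_representable_in TYPE('x \<Rightarrow>\<^sub>C real) act"
proof -
  have "dual_ball V N \<subseteq> dual V N" by (auto simp: dual_ball_def)
  then have "embedding_map euclidean (subtopology (weak_star_topology V N) (dual_ball V N)) evaluation"
    unfolding weak_star_topology_def subtopology_subtopology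
    using evaluation_dual_ball by (intro evaluation_embedding) auto
  then show ?thesis
    unfolding rosenthal_representable_in_def
    using rosenthal_V rep_continuous evaluation_equivariant by blast
qed

lemma evaluation_weak_star: "weak_star_G_embedding V N rep act evaluation"
proof -
  have "embedding_map euclidean (weak_star_topology V N) evaluation"
    unfolding weak_star_topology_def
    using evaluation_dual_ball by (intro evaluation_embedding) (auto simp: dual_ball_def)
  then show ?thesis using evaluation_equivariant by (simp add: weak_star_G_embedding_def)
qed

end

theorem theorem5p2:
  fixes m :: "'x::t2_space \<Rightarrow> 'x \<Rightarrow> 'x \<Rightarrow> 'x"
    and act :: "'g::topological_group_add \<Rightarrow> 'x \<Rightarrow> 'x"
    and n :: nat
  assumes "compact_median_algebra m"
    and "median_rank m = enat n"
    and "continuous_action act"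
    and "median_preserving m act"
  shows "rosenthal_representable_in TYPE('x \<Rightarrow>\<^sub>C real) act
    \<and> tame_system act
    \<and> (\<exists>(V :: ('x \<Rightarrow>\<^sub>C real) set) N h \<alpha>.
          rosenthal_space_on V N \<and> continuous_hom_Iso V N h
          \<and> weak_star_G_embedding V N h act \<alpha>)"
proof -
  interpret compact_median_algebra m by fact
  interpret median_action m n act
    using assms(2-4) by unfold_locales
  show ?thesis
    using representable tame rosenthal_V rep_continuous evaluation_weak_star by blast
qed

end
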